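(* Let $\Omega\subseteq\mathbb{R}^n$ be a domain (open connected set), and let $X(\Omega)\subset L^1_{\mathrm{loc}}(\Omega)$ be a Banach space with norm $\|\cdot\|_{X(\Omega)}$ such that $X(\Omega)$ satisfies the lattice property and the Hardy--Littlewood maximal operator $M\colon X(\Omega)\to X(\Omega)$ is bounded. Then $f\in W^1X(\Omega)$ if and only if $f\in X(\Omega)$ and there exists a non-negative function $g\in X(\Omega)$ such that the inequality $$|f(x)-f(y)|\le |x-y|\,(g(x)+g(y))$$ holds for all $x,y\in\Omega\setminus S$ with $B(x,3|x-y|)\subset\Omega$, where $S\subset\Omega$ is a set of Lebesgue measure zero.
   Context: Functions are real-valued and measurable. $B(x,r)$ is the ball with center $x\in\mathbb{R}^n$ and radius $r>0$. Lattice property: for all $f,g\in X(\Omega)$ such that $|f|\le|g|$ a.e., it holds that $\|f\|_{X(\Omega)}\le\|g\|_{X(\Omega)}$. Maximal operator: for $g\in L^1_{\mathrm{loc}}(\mathbb{R}^n)$, $Mg(x)=\sup_{r>0}\frac{1}{|B(x,r)|}\int_{B(x,r)}|g(y)|\,dy$; a function $g$ on $\Omega$ is extended by $0$ outside $\Omega$, and $Mg$ is considered on $\Omega$. Boundedness of $M$ on $X(\Omega)$ means there is a constant $K$ with $Mg\in X(\Omega)$ and $\|Mg\|_{X(\Omega)}\le K\|g\|_{X(\Omega)}$ for all $g\in X(\Omega)$. A function $f\in L^1_{\mathrm{loc}}(\Omega)$ is weakly differentiable with weak gradient $\nabla f=(g_1,\dots,g_n)\in L^1_{\mathrm{loc}}(\Omega)$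 if $\int_\Omega f\,\frac{\partial\varphi}{\partial x_k}\,dx=-\int_\Omega g_k\varphi\,dx$ for all $\varphi\in C_0^\infty(\Omega)$, $k=1,\dots,n$. The Sobolev space $W^1X(\Omega)$ is the space of weakly differentiable functions $f$ with $f\in X(\Omega)$ and $\nabla f\in X(\Omega)$, where $\nabla f\in X(\Omega)$ is understood as $|\nabla f|\in X(\Omega)$; its norm is $\|f\|_{X(\Omega)}+\|\nabla f\|_{X(\Omega)}$.
   Formalization: The lattice property is taken in its solid form: a measurable f with |f| ≤ |g| a.e. for some g in X(Ω) itself lies in X(Ω). With monotonicity only for f, g in X(Ω) the "if" part fails, e.g. for bounded uniformly continuous functions on the line and the tent function. *)

theory Defs
  imports "HOL-Analysis.Analysis"
begin

text \<open>
  Functions on \<open>\<Omega>\<close> are represented by total functions on \<open>real^'n\<close> whose values outside \<open>\<Omega>\<close>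
  are irrelevant; measurability and ``almost everywhere'' refer to Lebesgue measure on \<open>\<Omega>\<close>.
\<close>

definition L1_loc :: "(real^'n) set \<Rightarrow> (real^'n \<Rightarrow> real) set" where
  "L1_loc \<Omega> = {f \<in> borel_measurable (lebesgue_on \<Omega>).
     \<forall>K. compact K \<and> K \<subseteq> \<Omega> \<longrightarrow> set_integrable lebesgue K f}"

text \<open>
  A Banach space \<open>X \<subseteq> L\<^sup>1\<^sub>l\<^sub>o\<^sub>c(\<Omega>)\<close> with norm \<open>N\<close>. Its elements are classes of functions modulo
  equality almost everywhere: \<open>X\<close> is the set of all representatives, so \<open>X\<close> is saturated and
  \<open>N\<close> is invariant under that relation, and \<open>N\<close> vanishes exactly on the class of zero.
  The value of \<open>N\<close> outside \<open>X\<close> is never constrained.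
\<close>

locale banach_function_space =
  fixes \<Omega> :: "(real^'n) set"
    and X :: "(real^'n \<Rightarrow> real) set"
    and N :: "(real^'n \<Rightarrow> real) \<Rightarrow> real"
  assumes subset_L1_loc: "X \<subseteq> L1_loc \<Omega>"
    and ae_closed: "\<lbrakk>f \<in> X; g \<in> borel_measurable (lebesgue_on \<Omega>);
          AE x in lebesgue_on \<Omega>. f x = g x\<rbrakk> \<Longrightarrow> g \<in> X"
    and norm_ae_cong: "\<lbrakk>f \<in> X; g \<in> X; AE x in lebesgue_on \<Omega>. f x = g x\<rbrakk> \<Longrightarrow> N f = N g"
    and zero_mem: "(\<lambda>x. 0) \<in> X"
    and add_mem: "\<lbrakk>f \<in> X; g \<in> X\<rbrakk> \<Longrightarrow> (\<lambda>x. f x + g x) \<in> X"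
    and scale_mem: "f \<in> X \<Longrightarrow> (\<lambda>x. c * f x) \<in> X"
    and norm_nonneg: "f \<in> X \<Longrightarrow> 0 \<le> N f"
    and norm_eq_0_iff: "f \<in> X \<Longrightarrow> N f = 0 \<longleftrightarrow> (AE x in lebesgue_on \<Omega>. f x = 0)"
    and norm_triangle: "\<lbrakk>f \<in> X; g \<in> X\<rbrakk> \<Longrightarrow> N (\<lambda>x. f x + g x) \<le> N f + N g"
    and norm_scale: "f \<in> X \<Longrightarrow> N (\<lambda>x. c * f x) = \<bar>c\<bar> * N f"
    and complete: "\<lbrakk>\<And>n. u n \<in> X;
          \<forall>e>0. \<exists>n0. \<forall>m\<ge>n0. \<forall>n\<ge>n0. N (\<lambda>x. u m x - u n x) < e\<rbrakk>
        \<Longrightarrow> \<exists>f\<in>X. (\<lambda>n. N (\<lambda>x. u n x - f x)) \<longlonglongrightarrow> 0"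

text \<open>
  As usual for Banach function lattices, membership is part of the lattice property: a measurable
  function dominated by an element of \<open>X\<close> belongs to \<open>X\<close>. (Equivalently, the norm is read as
  infinite off \<open>X\<close>.) Monotonicity of the norm on \<open>X\<close> alone also holds for the bounded uniformly
  continuous functions on the line with the sup norm. The maximal operator is bounded there, but
  the tent function \<open>max 0 (1 - \<bar>x\<bar>)\<close> satisfies the pointwise inequality with a constant \<open>g\<close>
  although the modulus of its gradient is not in the space.
\<close>

definition lattice_property ::
    "(real^'n) set \<Rightarrow> (real^'n \<Rightarrow> real) set \<Rightarrow> ((real^'n \<Rightarrow> real) \<Rightarrow> real) \<Rightarrow> bool" where
  "lattice_property \<Omega> X N \<longleftrightarrow>
     (\<forall>f\<in>borel_measurable (lebesgue_on \<Omega>). \<forall>g\<in>X.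
        (AE x in lebesgue_on \<Omega>. \<bar>f x\<bar> \<le> \<bar>g x\<bar>) \<longrightarrow> f \<in> X \<and> N f \<le> N g)"

definition zero_extend :: "(real^'n) set \<Rightarrow> (real^'n \<Rightarrow> real) \<Rightarrow> real^'n \<Rightarrow> real" where
  "zero_extend \<Omega> g = (\<lambda>x. if x \<in> \<Omega> then g x else 0)"

definition maximal_function :: "(real^'n \<Rightarrow> real) \<Rightarrow> real^'n \<Rightarrow> ennreal" where
  "maximal_function g x =
     (SUP r\<in>{0<..}. (\<integral>\<^sup>+y\<in>ball x r. ennreal \<bar>g y\<bar> \<partial>lebesgue) / emeasure lebesgue (ball x r))"

text \<open>
  The maximal function takes values in \<open>[0,\<infinity>]\<close>; being an element of the space \<open>X\<close> of real
  functions includes that it is finite almost everywhere on \<open>\<Omega>\<close>.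
\<close>

definition maximal_operator_bounded ::
    "(real^'n) set \<Rightarrow> (real^'n \<Rightarrow> real) set \<Rightarrow> ((real^'n \<Rightarrow> real) \<Rightarrow> real) \<Rightarrow> bool" where
  "maximal_operator_bounded \<Omega> X N \<longleftrightarrow>
     (\<exists>K. \<forall>g\<in>X.
        (AE x in lebesgue_on \<Omega>. maximal_function (zero_extend \<Omega> g) x < \<infinity>) \<and>
        (\<lambda>x. enn2real (maximal_function (zero_extend \<Omega> g) x)) \<in> X \<and>
        N (\<lambda>x. enn2real (maximal_function (zero_extend \<Omega> g) x)) \<le> K * N g)"

definition partial_derivative :: "'n \<Rightarrow> (real^'n \<Rightarrow> real) \<Rightarrow> real^'n \<Rightarrow> real" where
  "partial_derivative k \<phi> x = frechet_derivative \<phi> (at x) (axis k 1)"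

fun C_k :: "nat \<Rightarrow> (real^'n \<Rightarrow> real) \<Rightarrow> bool" where
  "C_k 0 \<phi> \<longleftrightarrow> continuous_on UNIV \<phi>"
| "C_k (Suc m) \<phi> \<longleftrightarrow> (\<forall>x. \<phi> differentiable (at x)) \<and> (\<forall>k. C_k m (partial_derivative k \<phi>))"

definition test_functions :: "(real^'n) set \<Rightarrow> (real^'n \<Rightarrow> real) set" where
  "test_functions \<Omega> =
     {\<phi>. (\<forall>m. C_k m \<phi>) \<and> compact (closure {x. \<phi> x \<noteq> 0}) \<and> closure {x. \<phi> x \<noteq> 0} \<subseteq> \<Omega>}"

definition weak_gradient ::
    "(real^'n) set \<Rightarrow> (real^'n \<Rightarrow> real) \<Rightarrow> (real^'n \<Rightarrow> real^'n) \<Rightarrow> bool" where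
  "weak_gradient \<Omega> f G \<longleftrightarrow>
     f \<in> L1_loc \<Omega> \<and> (\<forall>k. (\<lambda>x. G x $ k) \<in> L1_loc \<Omega>) \<and>
     (\<forall>\<phi>\<in>test_functions \<Omega>. \<forall>k.
        (LINT x:\<Omega>|lebesgue. f x * partial_derivative k \<phi> x) =
        - (LINT x:\<Omega>|lebesgue. G x $ k * \<phi> x))"

definition W1 :: "(real^'n) set \<Rightarrow> (real^'n \<Rightarrow> real) set \<Rightarrow> (real^'n \<Rightarrow> real) set" where
  "W1 \<Omega> X = {f \<in> X. \<exists>G. weak_gradient \<Omega> f G \<and> (\<lambda>x. norm (G x)) \<in> X}"

end

theory Submission imports Defs begin

text \<open>
  A function of \<open>W\<^sup>1X(\<Omega>)\<close> satisfies the pointwise inequality with a multiple of the maximal function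
  of its gradient; conversely, the pointwise inequality bounds difference quotients and so forces a
  weak gradient dominated by a multiple of \<open>g\<close>. Both implications hold for locally integrable
  functions. The space enters at the end: boundedness of the maximal operator puts the
  function \<open>g\<close> of the first half into \<open>X\<close>, and the lattice property puts the modulus of the gradient
  of the second half into \<open>X\<close>.
  
  From the gradient to the inequality. For fixed \<open>v\<close>, testing the weak gradient against smooth bumps
  that tend to indicators of boxes gives \<open>f(p + v) - f(p) = \<integral> G(p + t v) \<bullet> v dt\<close> over \<open>0 \<le> t \<le> 1\<close>,
  for almost every \<open>p\<close> (\<open>AE_translation_difference_eq\<close>). Integrating its absolute value over
  \<open>\<bar>v\<bar> < d\<close> and exchanging the integrals produces averages of \<open>\<bar>G\<bar>\<close> over balls with centre \<open>p\<close>, whence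
  \<open>\<integral> \<bar>f(z) - f(p)\<bar> dz \<le> d \<bar>B(p,d)\<bar> M\<bar>G\<bar>(p)\<close> over \<open>z \<in> B(p,d)\<close>
  (\<open>nn_integral_ball_difference_le\<close>). The values at \<open>x\<close> and \<open>y\<close> are then compared through the points
  \<open>z\<close> of the ball around their midpoint with radius half their distance
  (\<open>difference_le_if_ball_averages\<close>).
  
  From the inequality to the gradient. The difference quotients of \<open>f\<close> along a coordinate axis, tested
  against smooth functions, converge to the distributional derivative. Up to a translation of one
  part, which is negligible in the limit, they are dominated by \<open>2 g\<close>
  (\<open>weak_partial_derivative_exists\<close>). A sequence dominated by a locally integrable function has convex
  combinations that converge almost everywhere, by a Hilbert space argument
  (\<open>convergent_iterated_midpoints\<close>); by dominated convergence their limit is the weak derivative, and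
  it inherits the bound \<open>2 g\<close> (\<open>bounded_density_of_weak_limit\<close>).
\<close>

section \<open>Smooth bumps on boxes\<close>

text \<open>
  The derivatives of \<open>exp (- 1 / t)\<close> (extended by \<open>0\<close> to \<open>t \<le> 0\<close>) are linear combinations of the
  functions below, so this family is closed under differentiation.
\<close>

definition flat_exp :: "nat \<Rightarrow> real \<Rightarrow> real" where
  "flat_exp j t = (if t > 0 then inverse t ^ j * exp (- inverse t) else 0)"

lemma flat_exp_nonpos [simp]: "t \<le> 0 \<Longrightarrow> flat_exp j t = 0"
  by (simp add: flat_exp_def)

lemma flat_exp_tendsto_0: "(flat_exp j \<longlongrightarrow> 0) (at 0)"
proof -
  have "((\<lambda>t. inverse t ^ j / exp (inverse t)) \<longlongrightarrow> 0) (at_right (0::real))"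
    by (rule filterlim_compose[OF tendsto_power_div_exp_0 filterlim_inverse_at_top_right])
  moreover have "eventually (\<lambda>t. inverse t ^ j / exp (inverse t) = flat_exp j t) (at_right (0::real))"
    by (auto simp: eventually_at_filter flat_exp_def exp_minus field_simps)
  ultimately have r: "(flat_exp j \<longlongrightarrow> 0) (at_right 0)"
    by (rule Lim_transform_eventually)
  have "eventually (\<lambda>t. 0 = flat_exp j t) (at_left (0::real))"
    by (auto simp: eventually_at_filter)
  then have l: "(flat_exp j \<longlongrightarrow> 0) (at_left 0)"
    by (rule Lim_transform_eventually[OF tendsto_const])
  from l r show ?thesis
    by (simp add: filterlim_split_at)
qed

lemma flat_exp_has_derivative:
  "(flat_exp j has_real_derivative flat_exp (j + 2) t - real j * flat_exp (j + 1) t) (at t)"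
proof -
  consider "t > 0" | "t < 0" | "t = 0" by linarith
  then show ?thesis
  proof cases
    case 1
    have "((\<lambda>t. inverse t ^ j * exp (- inverse t)) has_real_derivative
        flat_exp (j + 2) t - real j * flat_exp (j + 1) t) (at t)"
    proof (cases j)
      case 0
      then show ?thesis using 1
        by (auto intro!: derivative_eq_intros simp: flat_exp_def field_simps power2_eq_square)
    next
      case (Suc i)
      then show ?thesis using 1
        by (auto intro!: derivative_eq_intros simp: flat_exp_def power2_eq_square power_add algebra_simps simp flip: power_Suc)
    qed
    then show ?thesis
      by (rule has_field_derivative_transform_within_open[of _ _ _ "{0<..}"])
        (use 1 in \<open>auto simp: flat_exp_def\<close>)
  next
    case 2
    have "((\<lambda>_. 0) has_real_derivative flat_exp (j + 2) t - real j * flat_exp (j + 1) t) (at t)"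
      using 2 by simp
    then show ?thesis
      by (rule has_field_derivative_transform_within_open[of _ _ _ "{..<0}"]) (use 2 in auto)
  next
    case 3
    have "(\<lambda>h. (flat_exp j (0 + h) - flat_exp j 0) / h) = flat_exp (j + 1)"
      by (auto simp: flat_exp_def field_simps)
    then show ?thesis
      using 3 flat_exp_tendsto_0[of "j + 1"] by (simp add: DERIV_def)
  qed
qed

text \<open>
  An algebra of functions that contains the partial derivatives of its members consists of smooth
  functions. This turns smoothness of a product of \<open>exp (- 1 / t)\<close> bumps into one induction on the
  way a function is built, instead of a computation of its iterated derivatives.
\<close>

inductive flat_exp_algebra :: "(real^'n \<Rightarrow> real) \<Rightarrow> bool" where
  const: "flat_exp_algebra (\<lambda>x. c)"
| flat: "flat_exp_algebra (\<lambda>x. flat_exp j (s * x $ i + c))"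
| add: "flat_exp_algebra f \<Longrightarrow> flat_exp_algebra g \<Longrightarrow> flat_exp_algebra (\<lambda>x. f x + g x)"
| mult: "flat_exp_algebra f \<Longrightarrow> flat_exp_algebra g \<Longrightarrow> flat_exp_algebra (\<lambda>x. f x * g x)"

lemma partial_derivative_eqI:
  "(\<And>x. (f has_derivative f' x) (at x)) \<Longrightarrow> partial_derivative k f = (\<lambda>x. f' x (axis k 1))"
  unfolding partial_derivative_def by (rule ext) (metis frechet_derivative_at)

lemma flat_exp_algebra_derivative:
  fixes f :: "real^'n \<Rightarrow> real"
  assumes "flat_exp_algebra f"
  shows "(\<forall>x. f differentiable (at x)) \<and> (\<forall>k. flat_exp_algebra (partial_derivative k f))"
  using assms
proof induction
  case (const c)
  have "partial_derivative k (\<lambda>x. c) = (\<lambda>x. 0)" for k :: 'n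
    by (rule partial_derivative_eqI) (rule has_derivative_const)
  then show ?case by (auto intro: flat_exp_algebra.const)
next
  case (flat j s i c)
  have d: "((\<lambda>x. flat_exp j (s * x $ i + c)) has_derivative
      (\<lambda>h. (flat_exp (j + 2) (s * x $ i + c) + (- real j) * flat_exp (j + 1) (s * x $ i + c)) * (s * h $ i))) (at x)" for x
    by (rule has_derivative_compose[where f = "\<lambda>x. s * x $ i + c" and g = "flat_exp j",
          OF _ flat_exp_has_derivative[unfolded has_field_derivative_def], THEN has_derivative_eq_rhs])
      (auto intro!: derivative_eq_intros bounded_linear.has_derivative[OF bounded_linear_vec_nth])
  have e: "partial_derivative k (\<lambda>x. flat_exp j (s * x $ i + c)) =
      (\<lambda>x. (flat_exp (j + 2) (s * x $ i + c) + (- real j) * flat_exp (j + 1) (s * x $ i + c)) * (s * (axis k 1 :: real^'n) $ i))" for k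
    by (rule partial_derivative_eqI) (rule d)
  have "\<forall>k. flat_exp_algebra (partial_derivative k (\<lambda>x. flat_exp j (s * x $ i + c)))"
    unfolding e by (intro allI flat_exp_algebra.intros)
  then show ?case using d by (auto simp: differentiable_def)
next
  case (add f g)
  then have d: "((\<lambda>x. f x + g x) has_derivative (\<lambda>h. frechet_derivative f (at x) h + frechet_derivative g (at x) h)) (at x)" for x
    by (intro has_derivative_add) (auto simp: frechet_derivative_works[THEN iffD1])
  have e: "partial_derivative k (\<lambda>x. f x + g x) = (\<lambda>x. partial_derivative k f x + partial_derivative k g x)" for k
    by (subst partial_derivative_eqI[OF d]) (simp add: partial_derivative_def)
  have "\<forall>k. flat_exp_algebra (partial_derivative k (\<lambda>x. f x + g x))"
    unfolding e using add by (auto intro: flat_exp_algebra.add)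
  then show ?case using d by (auto simp: differentiable_def)
next
  case (mult f g)
  then have d: "((\<lambda>x. f x * g x) has_derivative (\<lambda>h. f x * frechet_derivative g (at x) h + frechet_derivative f (at x) h * g x)) (at x)" for x
    by (intro has_derivative_mult) (auto simp: frechet_derivative_works[THEN iffD1])
  have e: "partial_derivative k (\<lambda>x. f x * g x) = (\<lambda>x. f x * partial_derivative k g x + partial_derivative k f x * g x)" for k
    by (subst partial_derivative_eqI[OF d]) (simp add: partial_derivative_def)
  have "\<forall>k. flat_exp_algebra (partial_derivative k (\<lambda>x. f x * g x))"
    unfolding e using mult by (intro allI flat_exp_algebra.add flat_exp_algebra.mult) auto
  then show ?case using d by (auto simp: differentiable_def)
qed

lemma flat_exp_algebra_C_k: "flat_exp_algebra f \<Longrightarrow> C_k m f"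
proof (induction m arbitrary: f)
  case 0
  then have "\<forall>x. isCont f x"
    using flat_exp_algebra_derivative differentiable_imp_continuous_within by blast
  then show ?case by (simp add: continuous_on_eq_continuous_at)
next
  case (Suc m)
  then show ?case using flat_exp_algebra_derivative by auto
qed

text \<open>
  Each factor \<open>exp (- 1 / (m t))\<close> tends to \<open>1\<close> for \<open>t > 0\<close> as \<open>m\<close> grows. Hence these test functions
  tend boundedly to the indicator function of an open box, and the weak formulation can be tested
  against boxes. Translating a bump gives the bump of the translated box.
\<close>

definition box_bump :: "nat \<Rightarrow> real^'n \<Rightarrow> real^'n \<Rightarrow> real^'n \<Rightarrow> real" where
  "box_bump m a b x =
     (\<Prod>i\<in>UNIV. flat_exp 0 (real (Suc m) * (x $ i - a $ i)) * flat_exp 0 (real (Suc m) * (b $ i - x $ i)))"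

lemma flat_exp_0_bounds: "0 \<le> flat_exp 0 t" "flat_exp 0 t \<le> 1" and flat_exp_0_eq_0: "flat_exp 0 t = 0 \<longleftrightarrow> t \<le> 0"
  by (auto simp: flat_exp_def)

lemma box_bump_bounds: "0 \<le> box_bump m a b x" "box_bump m a b x \<le> 1"
  unfolding box_bump_def
  by (auto intro!: prod_nonneg prod_le_1 mult_le_one simp: flat_exp_0_bounds)

lemma box_bump_eq_0_iff: "box_bump m a b x = 0 \<longleftrightarrow> x \<notin> box a b"
  by (auto simp: box_bump_def flat_exp_0_eq_0 mem_box_cart zero_less_mult_iff mult_le_0_iff not_less)

lemma flat_exp_algebra_box_bump: "flat_exp_algebra (box_bump m a b)"
proof -
  have 1: "flat_exp_algebra (\<lambda>x. flat_exp 0 (real (Suc m) * (x $ i - a $ i)))" for i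
    using flat_exp_algebra.flat[of 0 "real (Suc m)" i "- real (Suc m) * a $ i"] by (simp add: algebra_simps)
  have 2: "flat_exp_algebra (\<lambda>x. flat_exp 0 (real (Suc m) * (b $ i - x $ i)))" for i
    using flat_exp_algebra.flat[of 0 "- real (Suc m)" i "real (Suc m) * b $ i"] by (simp add: algebra_simps)
  have "flat_exp_algebra (\<lambda>x. \<Prod>i\<in>A. flat_exp 0 (real (Suc m) * (x $ i - a $ i)) * flat_exp 0 (real (Suc m) * (b $ i - x $ i)))"
    if "finite A" for A
    using that by induction (auto intro!: flat_exp_algebra.mult 1 2 flat_exp_algebra.const simp del: of_nat_Suc)
  then show ?thesis by (simp add: box_bump_def[abs_def])
qed

lemma box_bump_test_function:
  assumes "cbox a b \<subseteq> \<Omega>"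
  shows "box_bump m a b \<in> test_functions \<Omega>"
proof -
  have "{x. box_bump m a b x \<noteq> 0} \<subseteq> cbox a b"
    using box_subset_cbox by (auto simp: box_bump_eq_0_iff)
  then have "closure {x. box_bump m a b x \<noteq> 0} \<subseteq> cbox a b"
    by (intro closure_minimal closed_cbox)
  then show ?thesis
    using assms by (auto simp: test_functions_def flat_exp_algebra_C_k flat_exp_algebra_box_bump
        intro: bounded_subset[OF bounded_cbox \<open>{x. box_bump m a b x \<noteq> 0} \<subseteq> cbox a b\<close>])
qed

lemma box_bump_translate: "box_bump m a b (x - u) = box_bump m (a + u) (b + u) x"
  by (simp add: box_bump_def algebra_simps)

lemma box_bump_tendsto:
  fixes x :: "real^'n"
  shows "(\<lambda>m. box_bump m a b x) \<longlonglongrightarrow> indicator (box a b) x"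
proof (cases "x \<in> box a b")
  case False
  then show ?thesis by (simp add: box_bump_eq_0_iff[THEN iffD2])
next
  case True
  have *: "(\<lambda>m. flat_exp 0 (real (Suc m) * t)) \<longlonglongrightarrow> 1" if "t > 0" for t
  proof -
    have "(\<lambda>m. exp (- (inverse (real (Suc m)) * inverse t))) \<longlonglongrightarrow> exp (- (0 * inverse t))"
      by (intro tendsto_intros LIMSEQ_inverse_real_of_nat)
    then show ?thesis using that by (simp add: flat_exp_def)
  qed
  have "(\<lambda>m. box_bump m a b x) \<longlonglongrightarrow> (\<Prod>i\<in>(UNIV::'n set). 1 * 1)"
    unfolding box_bump_def
    by (rule tendsto_prod, rule tendsto_mult) (use True in \<open>auto simp: mem_box_cart simp del: of_nat_Suc intro!: *\<close>)
  then show ?thesis using True by simp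
qed

section \<open>Test functions\<close>

lemma test_function_has_derivative:
  assumes "\<phi> \<in> test_functions \<Omega>"
  shows "(\<phi> has_derivative (\<lambda>v. \<Sum>k\<in>UNIV. v $ k * partial_derivative k \<phi> x)) (at x)"
proof -
  from assms have "C_k 1 \<phi>" by (simp add: test_functions_def)
  then have d: "\<phi> differentiable (at x)" by simp
  then have w: "(\<phi> has_derivative frechet_derivative \<phi> (at x)) (at x)"
    by (simp add: frechet_derivative_works)
  have l: "linear (frechet_derivative \<phi> (at x))" using w has_derivative_linear by blast
  have "frechet_derivative \<phi> (at x) v = (\<Sum>k\<in>UNIV. v $ k * partial_derivative k \<phi> x)" for v
  proof -
    have "v = (\<Sum>k\<in>UNIV. v $ k *\<^sub>R axis k 1)"
      using basis_expansion[of v] by (simp add: scalar_mult_eq_scaleR)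
    then have "frechet_derivative \<phi> (at x) v = frechet_derivative \<phi> (at x) (\<Sum>k\<in>UNIV. v $ k *\<^sub>R axis k 1)"
      by simp
    also have "\<dots> = (\<Sum>k\<in>UNIV. v $ k * partial_derivative k \<phi> x)"
      by (simp add: linear_sum[OF l] linear_scale[OF l] partial_derivative_def)
    finally show ?thesis .
  qed
  then have "frechet_derivative \<phi> (at x) = (\<lambda>v. \<Sum>k\<in>UNIV. v $ k * partial_derivative k \<phi> x)" by auto
  then show ?thesis using w by simp
qed

lemma test_function_continuous:
  assumes "\<phi> \<in> test_functions \<Omega>"
  shows "continuous_on UNIV \<phi>" "continuous_on UNIV (partial_derivative k \<phi>)"
proof -
  from assms have "C_k 0 \<phi>" "C_k (Suc 0) \<phi>" unfolding test_functions_def by blast+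
  then show "continuous_on UNIV \<phi>" "continuous_on UNIV (partial_derivative k \<phi>)" by simp_all
qed

lemma test_function_measurable:
  assumes "\<phi> \<in> test_functions \<Omega>"
  shows "\<phi> \<in> borel_measurable borel" "partial_derivative k \<phi> \<in> borel_measurable borel"
  using test_function_continuous[OF assms] by (auto intro: borel_measurable_continuous_onI)

lemma partial_derivative_support:
  fixes \<phi> :: "real^'n \<Rightarrow> real"
  assumes "partial_derivative k \<phi> x \<noteq> 0"
  shows "x \<in> closure {x. \<phi> x \<noteq> 0}"
proof (rule ccontr)
  let ?U = "- closure {x. \<phi> x \<noteq> 0}"
  assume "x \<notin> closure {x. \<phi> x \<noteq> 0}"
  then have x: "x \<in> ?U" by simp
  have z: "0 = \<phi> y" if "y \<in> ?U" for y
  proof (rule ccontr)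
    assume "0 \<noteq> \<phi> y"
    then have "y \<in> {x. \<phi> x \<noteq> 0}" by simp
    with that closure_subset[of "{x. \<phi> x \<noteq> 0}"] show False by blast
  qed
  have "open ?U" by (rule open_Compl[OF closed_closure])
  have "(\<phi> has_derivative (\<lambda>_. 0)) (at x)"
    by (rule has_derivative_transform_within_open[OF has_derivative_const[of "0::real"] \<open>open ?U\<close> x z])
  then have "frechet_derivative \<phi> (at x) = (\<lambda>_. 0)"
    by (rule frechet_derivative_at[symmetric])
  then show False using assms by (simp add: partial_derivative_def)
qed

lemma bounded_if_compact_support:
  fixes \<phi> :: "'a::topological_space \<Rightarrow> real"
  assumes "continuous_on UNIV \<phi>" "compact K" "\<And>x. \<phi> x \<noteq> 0 \<Longrightarrow> x \<in> K"
  obtains B where "B \<ge> 0" "\<And>x. \<bar>\<phi> x\<bar> \<le> B"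
proof -
  have "bounded (\<phi> ` K)"
    using assms by (intro compact_imp_bounded compact_continuous_image) (auto intro: continuous_on_subset)
  then obtain B where "\<forall>y\<in>\<phi> ` K. norm y \<le> B" by (auto simp: bounded_iff)
  then have "\<bar>\<phi> x\<bar> \<le> max B 0" for x
    by (cases "x \<in> K") (use assms(3)[of x] in force)+
  then show ?thesis using that[of "max B 0"] by auto
qed

lemma test_function_compact_support:
  assumes "\<phi> \<in> test_functions \<Omega>"
  shows "compact (closure {x. \<phi> x \<noteq> 0})" "closure {x. \<phi> x \<noteq> 0} \<subseteq> \<Omega>"
  using assms by (auto simp: test_functions_def)

lemma test_function_bounded:
  assumes "\<phi> \<in> test_functions \<Omega>"
  obtains B where "B \<ge> 0" "\<And>x. \<bar>\<phi> x\<bar> \<le> B"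
  using bounded_if_compact_support[OF test_function_continuous(1)[OF assms] test_function_compact_support(1)[OF assms]]
    closure_subset[of "{x. \<phi> x \<noteq> 0}"] by blast

lemma partial_derivative_bounded:
  assumes "\<phi> \<in> test_functions \<Omega>"
  shows "\<exists>B\<ge>0. \<forall>x. \<bar>partial_derivative k \<phi> x\<bar> \<le> B"
  by (rule bounded_if_compact_support[OF test_function_continuous(2)[OF assms] test_function_compact_support(1)[OF assms]
    partial_derivative_support]) auto

text \<open>
  The gradient is continuous with compact support, hence bounded. The Lipschitz bound dominates the
  difference quotients of a test function whenever a limit is taken under the integral.
\<close>

lemma test_function_Lipschitz:
  assumes "\<phi> \<in> test_functions \<Omega>"
  obtains L where "L \<ge> 0" "\<And>x y. \<bar>\<phi> x - \<phi> y\<bar> \<le> L * norm (x - y)"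
proof -
  obtain B where B: "\<And>k. B k \<ge> 0" "\<And>k x. \<bar>partial_derivative k \<phi> x\<bar> \<le> B k"
    using partial_derivative_bounded[OF assms] by metis
  have "norm (\<Sum>k\<in>UNIV. v $ k * partial_derivative k \<phi> x) \<le> norm v * sum B UNIV" for v x
    by (rule order_trans[OF norm_sum])
      (auto simp: sum_distrib_left abs_mult intro!: sum_mono mult_mono B component_le_norm_cart)
  then have on: "onorm (\<lambda>v. \<Sum>k\<in>UNIV. v $ k * partial_derivative k \<phi> x) \<le> sum B UNIV" for x
    by (intro onorm_bound) (auto simp: mult.commute B sum_nonneg)
  have "norm (\<phi> x - \<phi> y) \<le> sum B UNIV * norm (x - y)" for x y
    by (rule differentiable_bound[where S = UNIV and f = \<phi> and f' = "\<lambda>x v. \<Sum>k\<in>UNIV. v $ k * partial_derivative k \<phi> x"])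
      (auto intro: test_function_has_derivative[OF assms] on)
  then show ?thesis using that[of "sum B UNIV"] by (auto simp: B sum_nonneg)
qed

section \<open>Functions with vanishing integrals over boxes\<close>

text \<open>
  The sets over which \<open>w\<close>, cut off outside the box, has integral zero form a Dynkin system. Open
  boxes are stable under intersection and generate the Borel sets, so all integrals of \<open>w\<close> vanish.
\<close>

lemma AE_zero_if_box_integrals_zero:
  fixes w :: "'a::euclidean_space \<Rightarrow> real"
  assumes int: "set_integrable lborel (cbox a b) w"
    and zero: "\<And>c d. cbox c d \<subseteq> cbox a b \<Longrightarrow> (LINT x:box c d|lborel. w x) = 0"
  shows "AE x in lborel. x \<in> cbox a b \<longrightarrow> w x = 0"
proof -
  define h where "h x = indicator (box a b) x * w x" for x
  have "set_integrable lborel (box a b) w"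
    by (rule set_integrable_subset[OF int]) (auto simp: box_subset_cbox)
  then have h: "integrable lborel h"
    by (simp add: set_integrable_def h_def[abs_def])
  have total: "(\<integral>x. h x \<partial>lborel) = 0"
    using zero[of a b] by (simp add: h_def[abs_def] set_lebesgue_integral_def)
  have "(LINT x:A|lborel. h x) = 0" if "A \<in> sets borel" for A
  proof -
    have "Int_stable (range (\<lambda>(a, b). box a b :: 'a set))"
      by (auto simp: Int_stable_def box_Int_box)
    moreover have "range (\<lambda>(a, b). box a b :: 'a set) \<subseteq> Pow UNIV" by simp
    moreover have "A \<in> sigma_sets UNIV (range (\<lambda>(a, b). box a b))"
      using that by (simp add: borel_eq_box)
    ultimately show ?thesis
    proof (induction rule: sigma_sets_induct_disjoint)
      case (basic A)
      then obtain c d where A: "A = box c d" by auto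
      obtain c' d' where cd: "box c d \<inter> box a b = box c' d'"
        by (rule that[OF box_Int_box])
      have "(LINT x:A|lborel. h x) = (LINT x:box c' d'|lborel. w x)"
        unfolding A cd[symmetric] h_def set_lebesgue_integral_def
        by (intro Bochner_Integration.integral_cong) (auto simp: indicator_def)
      also have "\<dots> = 0"
      proof (cases "box c' d' = {}")
        case False
        have "closure (box c' d') \<subseteq> closure (box a b)"
          using cd by (intro closure_mono) auto
        moreover have "box a b \<noteq> {}" using False cd by auto
        ultimately have "cbox c' d' \<subseteq> cbox a b"
          using False by simp
        then show ?thesis by (rule zero)
      qed (simp add: set_lebesgue_integral_def)
      finally show ?case .
    next
      case empty
      then show ?case by (simp add: set_lebesgue_integral_def)
    next
      case (compl A)
      then have A: "A \<in> sets borel" by (simp add: borel_eq_box)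
      have "(LINT x:UNIV - A|lborel. h x) = (\<integral>x. h x \<partial>lborel) - (LINT x:A|lborel. h x)"
      proof -
        have "integrable lborel (\<lambda>x. indicator A x *\<^sub>R h x)"
          using h A by (intro integrable_mult_indicator) auto
        moreover have "(LINT x:UNIV - A|lborel. h x) = (\<integral>x. h x - indicator A x *\<^sub>R h x \<partial>lborel)"
          unfolding set_lebesgue_integral_def
          by (intro Bochner_Integration.integral_cong) (auto simp: indicator_def)
        ultimately show ?thesis
          unfolding set_lebesgue_integral_def using h by simp
      qed
      then show ?case using compl total by simp
    next
      case (union A)
      then have A: "A i \<in> sets borel" for i by (auto simp: borel_eq_box)
      have "set_integrable lborel (\<Union>i. A i) h"
        unfolding set_integrable_def using h A by (intro integrable_mult_indicator) auto
      then have "(LINT x:(\<Union>i. A i)|lborel. h x) = (\<Sum>i. (LINT x:(A i)|lborel. h x))"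
        using A union(1) by (intro lebesgue_integral_countable_add) (auto simp: disjoint_family_on_def)
      then show ?case using union by simp
    qed
  qed
  then have "AE x in lborel. h x = 0"
    using h by (intro density_unique_real) auto
  moreover have "AE x in lborel. x \<notin> cbox a b - box a b"
    using negligible_frontier_interval[of a b]
    by (intro AE_not_in) (simp add: negligible_iff_null_sets null_sets_completion_iff)
  ultimately show ?thesis
    by eventually_elim (auto simp: h_def)
qed

lemma AE_on_open_if_AE_on_boxes:
  fixes U :: "'a::euclidean_space set"
  assumes "open U" and "\<And>a b. cbox a b \<subseteq> U \<Longrightarrow> AE x in lborel. x \<in> cbox a b \<longrightarrow> P x"
  shows "AE x in lborel. x \<in> U \<longrightarrow> P x"
proof -
  obtain D where D: "countable D" "D \<subseteq> Pow U" "\<And>X. X \<in> D \<Longrightarrow> \<exists>a b. X = cbox a b" "\<Union>D = U"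
    using open_countable_Union_open_cbox[OF \<open>open U\<close>] by metis
  have "AE x in lborel. x \<in> X \<longrightarrow> P x" if X: "X \<in> D" for X
  proof -
    obtain a b where "X = cbox a b" using D(3)[OF X] by auto
    then show ?thesis using assms(2)[of a b] D(2) X by auto
  qed
  then have "AE x in lborel. \<forall>X\<in>D. x \<in> X \<longrightarrow> P x"
    by (subst AE_ball_countable[OF D(1)]) simp
  then show ?thesis
    by eventually_elim (simp add: D(4)[symmetric])
qed

section \<open>Iterated midpoints of bounded sequences\<close>

text \<open>
  The dyadic convex combinations of the tail \<open>u n, u (n + 1), \<dots>\<close>. Midpoints are all that the
  parallelogram identity below needs, and facts about convex combinations become inductions with no
  sums of weights.
\<close>

inductive_set iterated_midpoints :: "(nat \<Rightarrow> 'a \<Rightarrow> real) \<Rightarrow> nat \<Rightarrow> ('a \<Rightarrow> real) set"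
  for u n where
  member: "n \<le> j \<Longrightarrow> u j \<in> iterated_midpoints u n"
| midpoint: "f \<in> iterated_midpoints u n \<Longrightarrow> g \<in> iterated_midpoints u n \<Longrightarrow>
    (\<lambda>x. (f x + g x) / 2) \<in> iterated_midpoints u n"

lemma iterated_midpoints_antimono:
  assumes "f \<in> iterated_midpoints u m" "n \<le> m"
  shows "f \<in> iterated_midpoints u n"
  using assms by induction (auto intro: iterated_midpoints.intros)

lemma iterated_midpoints_measurable:
  assumes "f \<in> iterated_midpoints u n" "\<And>j. u j \<in> borel_measurable M"
  shows "f \<in> borel_measurable M"
  using assms by induction auto

lemma iterated_midpoints_bound:
  assumes "f \<in> iterated_midpoints u n" "\<And>j x. \<bar>u j x\<bar> \<le> 1"
  shows "\<bar>f x\<bar> \<le> 1"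
  using assms
proof (induction)
  case (midpoint f g)
  have "\<bar>f x\<bar> \<le> 1" "\<bar>g x\<bar> \<le> 1" using midpoint by auto
  then show ?case by (simp add: abs_le_iff)
qed auto

lemma (in finite_measure) integrable_if_bounded:
  fixes f :: "'a \<Rightarrow> real"
  assumes "f \<in> borel_measurable M" "\<And>x. \<bar>f x\<bar> \<le> C"
  shows "integrable M f" "integrable M (\<lambda>x. (f x)\<^sup>2)"
proof -
  show "integrable M f"
    using assms by (intro integrable_const_bound[where B = C]) auto
  have "(f x)\<^sup>2 \<le> C\<^sup>2" for x
    using power_mono[OF assms(2)[of x], of 2] by simp
  then show "integrable M (\<lambda>x. (f x)\<^sup>2)"
    using assms by (intro integrable_const_bound[where B = "C\<^sup>2"]) auto
qed

text \<open>
  A substitute for weak compactness. Nearly norm-minimal elements of the midpoint hulls of the tails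
  of \<open>u\<close> form a Cauchy sequence in \<open>L\<^sup>2\<close>: the minimal norms \<open>d n\<close> increase to a finite limit, and if
  two elements of one hull have nearly minimal norm, then the parallelogram identity bounds the norm
  of their difference, because their midpoint again has norm at least \<open>d n\<close>. On a finite measure
  space this sequence is also Cauchy in \<open>L\<^sup>1\<close>, so a subsequence converges almost everywhere.
\<close>

lemma (in finite_measure) convergent_iterated_midpoints:
  fixes u :: "nat \<Rightarrow> 'a \<Rightarrow> real"
  assumes meas: "\<And>j. u j \<in> borel_measurable M" and bd: "\<And>j x. \<bar>u j x\<bar> \<le> 1"
  obtains w where "\<And>n. w n \<in> iterated_midpoints u n" "AE x in M. convergent (\<lambda>n. w n x)"
proof -
  define C where "C = iterated_midpoints u"
  define Q where "Q f = (\<integral>x. (f x)\<^sup>2 \<partial>M)" for f :: "'a \<Rightarrow> real"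
  define \<delta> where "\<delta> n = inverse (real (Suc n))" for n
  have \<delta>_pos: "\<delta> n > 0" for n by (simp add: \<delta>_def)
  have \<delta>_anti: "\<delta> m \<le> \<delta> n" if "n \<le> m" for m n
    unfolding \<delta>_def using that by (intro le_imp_inverse_le) auto
  define d where "d n = (INF f\<in>C n. Q f)" for n
  have Cm: "f \<in> borel_measurable M" "\<And>x. \<bar>f x\<bar> \<le> 1" if "f \<in> C n" for f n
    using iterated_midpoints_measurable[OF that[unfolded C_def] meas]
      iterated_midpoints_bound[OF that[unfolded C_def] bd] by simp_all
  have Ci: "integrable M f" "integrable M (\<lambda>x. (f x)\<^sup>2)" if "f \<in> C n" for f n
    using integrable_if_bounded[OF Cm[OF that]] by auto
  have ne: "u n \<in> C n" for n by (simp add: C_def iterated_midpoints.member)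
  have Q0: "0 \<le> Q f" for f by (simp add: Q_def)
  have bdd: "bdd_below (Q ` C n)" for n using Q0 by (intro bdd_belowI[of _ 0]) auto
  have dle: "d n \<le> Q f" if "f \<in> C n" for f n
    unfolding d_def using bdd that by (rule cINF_lower)
  have anti: "C m \<subseteq> C n" if "n \<le> m" for m n
    unfolding C_def using that by (auto intro: iterated_midpoints_antimono)
  have "incseq d"
    unfolding d_def
    by (intro monoI cINF_superset_mono bdd anti order_refl) (use ne in auto)
  moreover have "d n \<le> measure M (space M)" for n
  proof -
    have "Q (u n) \<le> (\<integral>x. 1 \<partial>M)"
      unfolding Q_def by (intro integral_mono Ci(2)[OF ne])
        (use abs_square_le_1 bd in auto)
    then show ?thesis using dle[OF ne, of n] by simp
  qed
  ultimately have "convergent d"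
    by (metis incseq_convergent convergentI)
  then have Cd: "Cauchy d" by (rule convergent_Cauchy)
  have "\<exists>f\<in>C n. Q f < d n + \<delta> n" for n
    using \<delta>_pos[of n] cInf_lessD[of "Q ` C n" "d n + \<delta> n"] ne[of n] unfolding d_def by auto
  then obtain s where s: "\<And>n. s n \<in> C n" "\<And>n. Q (s n) < d n + \<delta> n" by metis
  have par: "Q (\<lambda>x. s n x - s m x) \<le> 2 * (d m - d n) + 4 * \<delta> n" if "n \<le> m" for n m
  proof -
    have sm: "s m \<in> C n" using s(1) anti that by blast
    define p where "p x = (s n x + s m x) / 2" for x
    have p: "p \<in> C n" unfolding p_def[abs_def] C_def
      using s(1)[of n] sm by (auto simp: C_def intro: iterated_midpoints.midpoint)
    have "Q (\<lambda>x. s n x - s m x) = (\<integral>x. 2 * (s n x)\<^sup>2 + 2 * (s m x)\<^sup>2 - 4 * (p x)\<^sup>2 \<partial>M)"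
      unfolding Q_def p_def by (intro Bochner_Integration.integral_cong) (auto simp: power2_eq_square field_simps)
    also have "\<dots> = 2 * Q (s n) + 2 * Q (s m) - 4 * Q p"
      unfolding Q_def using Ci(2)[OF s(1)] Ci(2)[OF p] by simp
    also have "\<dots> \<le> 2 * (d n + \<delta> n) + 2 * (d m + \<delta> m) - 4 * d n"
      using s(2)[of n] s(2)[of m] dle[OF p] by (smt (verit))
    also have "\<dots> \<le> 2 * (d m - d n) + 4 * \<delta> n"
    proof -
      have "\<delta> m \<le> \<delta> n" using that by (rule \<delta>_anti)
      then show ?thesis by simp
    qed
    finally show ?thesis .
  qed
  have sym: "Q (\<lambda>x. s n x - s m x) = Q (\<lambda>x. s m x - s n x)" for n m
    by (simp add: Q_def power2_commute)
  have Q_small: "\<exists>N. \<forall>i\<ge>N. \<forall>j\<ge>N. Q (\<lambda>x. s i x - s j x) < e" if "e > 0" for e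
  proof -
    obtain N1 where N1: "\<And>i j. i \<ge> N1 \<Longrightarrow> j \<ge> N1 \<Longrightarrow> norm (d i - d j) < e / 4"
      using CauchyD[OF Cd, of "e / 4"] \<open>e > 0\<close> by auto
    obtain N2 where N2: "\<delta> N2 < e / 8"
      using reals_Archimedean[of "e / 8"] \<open>e > 0\<close> by (auto simp: \<delta>_def)
    have *: "Q (\<lambda>x. s i x - s j x) < e" if "i \<le> j" "i \<ge> max N1 N2" for i j
    proof -
      have "\<delta> i \<le> \<delta> N2" using that by (intro \<delta>_anti) auto
      moreover have "\<bar>d j - d i\<bar> < e / 4" using N1[of j i] that by auto
      moreover have "e / 4 * 2 + e / 8 * 4 = e" by simp
      ultimately show ?thesis using par[OF that(1)] N2 by (smt (verit))
    qed
    have "Q (\<lambda>x. s i x - s j x) < e" if "i \<ge> max N1 N2" "j \<ge> max N1 N2" for i j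
      using *[of i j] *[of j i] sym[of i j] that by (cases "i \<le> j") auto
    then show ?thesis by blast
  qed
  have L1_small: "\<exists>N. \<forall>i\<ge>N. \<forall>j\<ge>N. (\<integral>x. norm (s i x - s j x) \<partial>M) < e" if "e > 0" for e
  proof -
    define V where "V = measure M (space M) + 1"
    have V: "V > 0" using measure_nonneg[of M "space M"] unfolding V_def by linarith
    define \<eta> where "\<eta> = e / V"
    have \<eta>: "\<eta> > 0" using V that by (simp add: \<eta>_def)
    obtain N where N: "\<And>i j. i \<ge> N \<Longrightarrow> j \<ge> N \<Longrightarrow> Q (\<lambda>x. s i x - s j x) < \<eta> * e"
      using Q_small[of "\<eta> * e"] \<eta> \<open>e > 0\<close> by auto
    have "(\<integral>x. norm (s i x - s j x) \<partial>M) < e" if ij: "i \<ge> N" "j \<ge> N" for i j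
    proof -
      have "integrable M (\<lambda>x. s i x - s j x)" using Ci(1)[OF s(1)] by auto
      have b2: "\<bar>s i x - s j x\<bar> \<le> 2" for x
        using Cm(2)[OF s(1)[of i], of x] Cm(2)[OF s(1)[of j], of x] by (simp add: abs_le_iff)
      have i2: "integrable M (\<lambda>x. (s i x - s j x)\<^sup>2)"
        by (rule integrable_if_bounded(2)[OF _ b2]) (use Cm(1)[OF s(1)] in auto)
      have "norm (s i x - s j x) \<le> \<eta> / 2 + (s i x - s j x)\<^sup>2 / (2 * \<eta>)" for x
      proof -
        \<comment> \<open>Young's inequality with weight \<open>\<eta>\<close> passes from \<open>L\<^sup>2\<close> to \<open>L\<^sup>1\<close>\<close>
        have "2 * \<eta> * \<bar>s i x - s j x\<bar> \<le> \<eta>\<^sup>2 + (s i x - s j x)\<^sup>2"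
          using sum_squares_bound[of \<eta> "\<bar>s i x - s j x\<bar>"] by simp
        then have "\<bar>s i x - s j x\<bar> \<le> (\<eta>\<^sup>2 + (s i x - s j x)\<^sup>2) / (2 * \<eta>)"
          using \<eta> by (simp add: pos_le_divide_eq mult.commute mult.left_commute)
        also have "\<dots> = \<eta> / 2 + (s i x - s j x)\<^sup>2 / (2 * \<eta>)"
          using \<eta> by (simp add: add_divide_distrib power2_eq_square)
        finally show ?thesis by simp
      qed
      then have "(\<integral>x. norm (s i x - s j x) \<partial>M) \<le> (\<integral>x. \<eta> / 2 + (s i x - s j x)\<^sup>2 / (2 * \<eta>) \<partial>M)"
        using Ci(1)[OF s(1)] i2 by (intro integral_mono) auto
      also have "\<dots> = \<eta> / 2 * measure M (space M) + Q (\<lambda>x. s i x - s j x) / (2 * \<eta>)"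
        using i2 by (simp add: Q_def)
      also have "\<dots> < \<eta> / 2 * V + (\<eta> * e) / (2 * \<eta>)"
        using N[OF ij] \<eta> by (intro add_strict_mono mult_strict_left_mono divide_strict_right_mono) (auto simp: V_def)
      also have "\<dots> = e" using \<eta> V by (simp add: \<eta>_def)
      finally show ?thesis .
    qed
    then show ?thesis by blast
  qed
  obtain r where r: "strict_mono r" "AE x in M. Cauchy (\<lambda>i. s (r i) x)"
    using cauchy_L1_AE_cauchy_subseq[OF Ci(1)[OF s(1)] L1_small] by blast
  show ?thesis
  proof (rule that)
    show "s (r n) \<in> iterated_midpoints u n" for n
      using s(1)[of "r n"] anti[OF seq_suble[OF r(1), of n]] unfolding C_def by blast
    show "AE x in M. convergent (\<lambda>n. s (r n) x)"
      using r(2) by (simp add: Cauchy_convergent_iff)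
  qed
qed

text \<open>
  Lebesgue measure has the same null sets as a finite measure with a strictly positive density.
\<close>

lemma convergent_iterated_midpoints_lborel:
  fixes u :: "nat \<Rightarrow> 'a::euclidean_space \<Rightarrow> real"
  assumes meas: "\<And>j. u j \<in> borel_measurable borel" and bd: "\<And>j x. \<bar>u j x\<bar> \<le> 1"
  obtains w where "\<And>n. w n \<in> iterated_midpoints u n" "AE x in lborel. convergent (\<lambda>n. w n x)"
proof -
  have "\<exists>\<rho> :: 'a \<Rightarrow> real. \<rho> \<in> borel_measurable lborel \<and> (\<forall>x. \<rho> x > 0) \<and> integrable lborel \<rho>"
    by (rule sigma_finite_measure.obtain_positive_integrable_function[OF sigma_finite_lborel]) blast
  then obtain \<rho> :: "'a \<Rightarrow> real" where \<rho>: "\<rho> \<in> borel_measurable lborel" "\<And>x. \<rho> x > 0" "integrable lborel \<rho>"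
    by blast
  let ?M = "density lborel \<rho>"
  interpret finite_measure ?M
  proof
    have "emeasure ?M (space ?M) = (\<integral>\<^sup>+x. \<rho> x \<partial>lborel)"
      using \<rho> by (simp add: emeasure_density)
    also have "\<dots> \<noteq> \<infinity>"
      using \<rho> by (subst nn_integral_eq_integral) (auto intro: less_imp_le)
    finally show "emeasure ?M (space ?M) \<noteq> \<infinity>" .
  qed
  obtain w where w: "\<And>n. w n \<in> iterated_midpoints u n" "AE x in ?M. convergent (\<lambda>n. w n x)"
    by (rule convergent_iterated_midpoints[of u]) (use meas bd in auto)
  then have "AE x in lborel. convergent (\<lambda>n. w n x)"
    using \<rho> by (subst (asm) AE_density) (auto simp: ennreal_less_zero_iff)
  with w(1) show ?thesis by (rule that)
qed

section \<open>Borel representatives and translations\<close>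

lemma zero_extend_measurable:
  assumes "open \<Omega>" "f \<in> borel_measurable (lebesgue_on \<Omega>)"
  shows "zero_extend \<Omega> f \<in> borel_measurable lebesgue"
  unfolding zero_extend_def
  by (rule borel_measurable_if_I) (use assms in auto)

text \<open>
  Translations and product measures are handled in the Borel algebra. Every function on \<open>\<Omega>\<close> is
  therefore replaced by a Borel function on the whole space that agrees almost everywhere with its
  extension by zero.
\<close>

lemma borel_representative:
  assumes "open \<Omega>" "f \<in> borel_measurable (lebesgue_on \<Omega>)"
  obtains f' where "f' \<in> borel_measurable borel" "AE x in lborel. f' x = zero_extend \<Omega> f x"
proof -
  obtain f' where "f' \<in> borel_measurable lborel" "AE x in lborel. zero_extend \<Omega> f x = f' x"
    using completion_ex_borel_measurable_real[OF zero_extend_measurable[OF assms]] by auto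
  then show ?thesis using that[of f'] by (auto simp: eq_commute)
qed

lemma borel_representative_set_integrable:
  assumes f: "f \<in> L1_loc \<Omega>" and \<Omega>: "open \<Omega>"
    and f': "f' \<in> borel_measurable borel" "AE x in lborel. f' x = zero_extend \<Omega> f x"
    and K: "compact K" "K \<subseteq> \<Omega>"
  shows "set_integrable lborel K f'"
proof -
  have [measurable]: "K \<in> sets borel" using K by (simp add: borel_compact)
  note [measurable] = f'(1)
  have "integrable lebesgue (\<lambda>x. indicator K x *\<^sub>R f x)"
    using f K by (simp add: L1_loc_def set_integrable_def)
  also have "(\<lambda>x. indicator K x *\<^sub>R f x) = (\<lambda>x. indicator K x *\<^sub>R zero_extend \<Omega> f x)"
    using K(2) by (intro ext) (auto simp: zero_extend_def split: split_indicator)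
  finally have i: "integrable lebesgue (\<lambda>x. indicator K x *\<^sub>R zero_extend \<Omega> f x)" .
  have "AE x in lebesgue. f' x = zero_extend \<Omega> f x"
    using f'(2) by (rule AE_completion)
  then have "AE x in lebesgue. indicator K x *\<^sub>R zero_extend \<Omega> f x = indicator K x *\<^sub>R f' x"
    by eventually_elim simp
  then have "integrable lebesgue (\<lambda>x. indicator K x *\<^sub>R f' x)"
    using i by (subst integrable_cong_AE[symmetric]) (auto intro: measurable_completion)
  then show ?thesis
    unfolding set_integrable_def by (subst (asm) integrable_completion) auto
qed

lemma borel_representative_integral:
  assumes f: "f \<in> borel_measurable (lebesgue_on \<Omega>)" and \<Omega>: "open \<Omega>"
    and f': "f' \<in> borel_measurable borel" "AE x in lborel. f' x = zero_extend \<Omega> f x"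
    and \<psi>: "\<psi> \<in> borel_measurable borel"
  shows "(LINT x:\<Omega>|lebesgue. f x * \<psi> x) = (\<integral>x. f' x * \<psi> x \<partial>lborel)"
proof -
  note [measurable] = f'(1) \<psi>
  have m: "zero_extend \<Omega> f \<in> borel_measurable lebesgue" "f' \<in> borel_measurable lebesgue"
    "\<psi> \<in> borel_measurable lebesgue"
    using zero_extend_measurable[OF \<Omega> f] by (auto intro!: measurable_completion)
  have "AE x in lebesgue. f' x = zero_extend \<Omega> f x"
    using f'(2) by (rule AE_completion)
  then have ae: "AE x in lebesgue. zero_extend \<Omega> f x * \<psi> x = f' x * \<psi> x"
    by eventually_elim simp
  have "(LINT x:\<Omega>|lebesgue. f x * \<psi> x) = (\<integral>x. zero_extend \<Omega> f x * \<psi> x \<partial>lebesgue)"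
    unfolding set_lebesgue_integral_def zero_extend_def
    by (intro Bochner_Integration.integral_cong) (auto simp: indicator_def)
  also have "\<dots> = (\<integral>x. f' x * \<psi> x \<partial>lebesgue)"
    by (rule integral_cong_AE[OF _ _ ae]) (intro borel_measurable_times m)+
  also have "\<dots> = (\<integral>x. f' x * \<psi> x \<partial>lborel)"
    by (rule integral_completion) measurable
  finally show ?thesis .
qed

lemma L1_locI:
  assumes "f \<in> borel_measurable borel" "\<And>K. compact K \<Longrightarrow> K \<subseteq> \<Omega> \<Longrightarrow> set_integrable lborel K f"
  shows "f \<in> L1_loc \<Omega>"
proof -
  have "f \<in> borel_measurable lebesgue" using assms(1) by (intro measurable_completion) auto
  then have "f \<in> borel_measurable (lebesgue_on \<Omega>)" by (rule measurable_restrict_space1)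
  moreover have "set_integrable lebesgue K f" if "compact K" "K \<subseteq> \<Omega>" for K
  proof -
    have [measurable]: "K \<in> sets borel" "f \<in> borel_measurable borel"
      using that assms by (simp_all add: borel_compact)
    show ?thesis
      using assms(2)[OF that] unfolding set_integrable_def by (subst integrable_completion) auto
  qed
  ultimately show ?thesis by (simp add: L1_loc_def)
qed

lemma AE_lebesgue_on_iff:
  assumes "open \<Omega>"
  shows "(AE x in lebesgue_on \<Omega>. P x) \<longleftrightarrow> (AE x in lborel. x \<in> \<Omega> \<longrightarrow> P x)"
  using assms by (subst AE_restrict_space_iff) (auto simp: AE_completion_iff)

lemma AE_lborel_translate:
  fixes u :: "'a::euclidean_space"
  assumes "AE x in lborel. P x"
  shows "AE x in lborel. P (x + u)"
  using AE_distrD[of "(+) u" lborel borel P, unfolded lborel_distr_plus] assms by (simp add: add.commute)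

lemma integral_lborel_translate:
  fixes u :: "'a::euclidean_space" and h :: "'a \<Rightarrow> real"
  assumes "h \<in> borel_measurable borel"
  shows "(\<integral>x. h (x + u) \<partial>lborel) = (\<integral>x. h x \<partial>lborel)"
  using integral_distr[of "(+) u" lborel borel h] assms by (simp add: lborel_distr_plus add.commute)

lemma integrable_lborel_translate:
  fixes u :: "'a::euclidean_space" and h :: "'a \<Rightarrow> real"
  assumes "integrable lborel h"
  shows "integrable lborel (\<lambda>x. h (x + u))"
  using integrable_distr_eq[of "(+) u" lborel borel h] assms by (simp add: lborel_distr_plus add.commute)

lemma integrable_mult_bounded_support:
  fixes f \<psi> :: "'a::euclidean_space \<Rightarrow> real"
  assumes "set_integrable lborel K f" "f \<in> borel_measurable borel" "\<psi> \<in> borel_measurable borel"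
    and "\<And>x. \<bar>\<psi> x\<bar> \<le> B" "\<And>x. \<psi> x \<noteq> 0 \<Longrightarrow> x \<in> K"
  shows "integrable lborel (\<lambda>x. f x * \<psi> x)"
proof (rule Bochner_Integration.integrable_bound)
  show "integrable lborel (\<lambda>x. B * (indicator K x *\<^sub>R f x))"
    using assms(1) by (auto simp: set_integrable_def)
  show "AE x in lborel. norm (f x * \<psi> x) \<le> norm (B * (indicator K x *\<^sub>R f x))"
  proof (rule AE_I2)
    fix x
    show "norm (f x * \<psi> x) \<le> norm (B * (indicator K x *\<^sub>R f x))"
      using assms(4)[of x] assms(5)[of x] mult_right_mono[of "\<bar>\<psi> x\<bar>" "\<bar>B\<bar>" "\<bar>f x\<bar>"]
      by (cases "\<psi> x = 0") (auto simp: abs_mult mult.commute)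
  qed
qed (use assms in measurable)

text \<open>
  Convolving with a test function makes a locally integrable function differentiable along lines:
  the derivative falls on the test function. The parameter set \<open>T\<close> keeps all translated supports
  inside one set \<open>K\<close> on which \<open>f\<close> is integrable.
\<close>

lemma translated_integral_has_derivative:
  fixes f :: "real^'n \<Rightarrow> real"
  assumes f: "f \<in> borel_measurable borel" "set_integrable lborel K f"
    and \<phi>: "\<phi> \<in> test_functions \<Omega>"
    and T: "t \<in> T" "\<And>s x. s \<in> T \<Longrightarrow> \<phi> (x - s *\<^sub>R v) \<noteq> 0 \<Longrightarrow> x \<in> K"
  shows "((\<lambda>s. \<integral>x. f x * \<phi> (x - s *\<^sub>R v) \<partial>lborel) has_real_derivative
      - (\<integral>x. f x * (\<Sum>k\<in>UNIV. v $ k * partial_derivative k \<phi> (x - t *\<^sub>R v)) \<partial>lborel)) (at t within T)"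
proof -
  define F where "F s = (\<integral>x. f x * \<phi> (x - s *\<^sub>R v) \<partial>lborel)" for s
  define D where "D x = (\<Sum>k\<in>UNIV. v $ k * partial_derivative k \<phi> (x - t *\<^sub>R v))" for x
  obtain B where B: "B \<ge> 0" "\<And>x. \<bar>\<phi> x\<bar> \<le> B" using test_function_bounded[OF \<phi>] by blast
  obtain L where L: "L \<ge> 0" "\<And>x y. \<bar>\<phi> x - \<phi> y\<bar> \<le> L * norm (x - y)" using test_function_Lipschitz[OF \<phi>] by blast
  note [measurable] = f(1) test_function_measurable[OF \<phi>]
  have int: "integrable lborel (\<lambda>x. f x * \<phi> (x - s *\<^sub>R v))" if "s \<in> T" for s
    by (rule integrable_mult_bounded_support[OF f(2,1), where B = B]) (use B T(2)[OF that] in auto)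
  have "((\<lambda>s. (F s - F t) / (s - t)) \<longlongrightarrow> - (\<integral>x. f x * D x \<partial>lborel)) (at t within T)"
    unfolding tendsto_at_iff_sequentially comp_def
  proof (intro allI impI)
    fix X assume X: "\<forall>i. X i \<in> T - {t}" "X \<longlonglongrightarrow> t"
    define q where "q i x = f x * ((\<phi> (x - X i *\<^sub>R v) - \<phi> (x - t *\<^sub>R v)) / (X i - t))" for i x
    have "(F (X i) - F t) / (X i - t) = (\<integral>x. q i x \<partial>lborel)" for i
    proof -
      have "F (X i) - F t = (\<integral>x. f x * \<phi> (x - X i *\<^sub>R v) - f x * \<phi> (x - t *\<^sub>R v) \<partial>lborel)"
        unfolding F_def using X int T(1) by (intro Bochner_Integration.integral_diff[symmetric]) auto
      also have "\<dots> / (X i - t) = (\<integral>x. q i x \<partial>lborel)"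
        unfolding q_def by (simp add: right_diff_distrib flip: integral_divide_zero)
      finally show ?thesis .
    qed
    moreover have "(\<lambda>i. \<integral>x. q i x \<partial>lborel) \<longlonglongrightarrow> (\<integral>x. f x * - D x \<partial>lborel)"
    proof (rule integral_dominated_convergence[where w = "\<lambda>x. (L * norm v) * \<bar>indicator K x *\<^sub>R f x\<bar>"])
      show "integrable lborel (\<lambda>x. (L * norm v) * \<bar>indicator K x *\<^sub>R f x\<bar>)"
        using f(2) unfolding set_integrable_def by (intro integrable_mult_right integrable_abs)
      show "AE x in lborel. (\<lambda>i. q i x) \<longlonglongrightarrow> f x * - D x"
      proof (rule AE_I2)
        fix x
        have "((\<lambda>s. \<phi> (x - s *\<^sub>R v)) has_derivative
            (\<lambda>h. \<Sum>k\<in>UNIV. (- (h *\<^sub>R v)) $ k * partial_derivative k \<phi> (x - t *\<^sub>R v))) (at t within T)"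
          by (rule has_derivative_compose[where g = \<phi> and f = "\<lambda>s. x - s *\<^sub>R v",
                OF _ test_function_has_derivative[OF \<phi>]])
            (auto intro!: derivative_eq_intros)
        then have "((\<lambda>s. \<phi> (x - s *\<^sub>R v)) has_real_derivative - D x) (at t within T)"
          unfolding has_field_derivative_def D_def
          by (rule has_derivative_eq_rhs) (auto simp: sum_distrib_left sum_negf algebra_simps)
        then have "((\<lambda>s. (\<phi> (x - s *\<^sub>R v) - \<phi> (x - t *\<^sub>R v)) / (s - t)) \<longlongrightarrow> - D x) (at t within T)"
          by (simp add: has_field_derivative_iff)
        then have "(\<lambda>i. (\<phi> (x - X i *\<^sub>R v) - \<phi> (x - t *\<^sub>R v)) / (X i - t)) \<longlonglongrightarrow> - D x"
          using X unfolding tendsto_at_iff_sequentially comp_def by blast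
        then show "(\<lambda>i. q i x) \<longlonglongrightarrow> f x * - D x"
          unfolding q_def by (intro tendsto_mult tendsto_const)
      qed
      show "AE x in lborel. norm (q i x) \<le> (L * norm v) * \<bar>indicator K x *\<^sub>R f x\<bar>" for i
      proof (rule AE_I2)
        fix x
        let ?d = "\<phi> (x - X i *\<^sub>R v) - \<phi> (x - t *\<^sub>R v)"
        have Xi: "X i \<in> T" "X i \<noteq> t" using X by auto
        have "\<bar>?d\<bar> \<le> L * norm ((x - X i *\<^sub>R v) - (x - t *\<^sub>R v))" by (rule L)
        also have "(x - X i *\<^sub>R v) - (x - t *\<^sub>R v) = (t - X i) *\<^sub>R v" by (simp add: algebra_simps)
        finally have "\<bar>?d\<bar> \<le> L * norm v * \<bar>X i - t\<bar>" by (simp add: mult_ac abs_minus_commute)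
        then have d: "\<bar>?d / (X i - t)\<bar> \<le> L * norm v"
          using Xi by (simp add: abs_divide pos_divide_le_eq)
        show "norm (q i x) \<le> (L * norm v) * \<bar>indicator K x *\<^sub>R f x\<bar>"
        proof (cases "x \<in> K")
          case True
          have "norm (q i x) = \<bar>?d / (X i - t)\<bar> * \<bar>f x\<bar>" by (simp add: q_def abs_mult)
          also have "\<dots> \<le> (L * norm v) * \<bar>f x\<bar>" by (intro mult_right_mono d) auto
          finally show ?thesis using True by simp
        next
          case False
          then have "\<phi> (x - X i *\<^sub>R v) = 0" "\<phi> (x - t *\<^sub>R v) = 0"
            using T Xi by blast+
          then show ?thesis using L(1) by (simp add: q_def)
        qed
      qed
    qed (auto simp: q_def D_def)
    ultimately show "(\<lambda>i. (F (X i) - F t) / (X i - t)) \<longlonglongrightarrow> - (\<integral>x. f x * D x \<partial>lborel)"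
      by simp
  qed
  then show ?thesis
    by (simp add: has_field_derivative_iff F_def D_def)
qed

section \<open>From the pointwise inequality to a weak gradient\<close>

text \<open>
  An interval around \<open>l\<close> is convex, so it contains the value of a linear functional at every iterated
  midpoint as soon as it contains its values along the sequence.
\<close>

lemma iterated_midpoints_functional_bound:
  fixes u :: "nat \<Rightarrow> 'a \<Rightarrow> real"
  assumes "f \<in> iterated_midpoints u n" and meas: "\<And>j. u j \<in> borel_measurable M" and bd: "\<And>j x. \<bar>u j x\<bar> \<le> 1"
    and h: "integrable M h" and close: "\<And>j. n \<le> j \<Longrightarrow> \<bar>(\<integral>x. u j x * h x \<partial>M) - l\<bar> \<le> e"
  shows "\<bar>(\<integral>x. f x * h x \<partial>M) - l\<bar> \<le> e"
  using assms(1)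
proof induction
  case (member j)
  then show ?case by (rule close)
next
  case (midpoint f g)
  have int: "integrable M (\<lambda>x. p x * h x)" if "p \<in> iterated_midpoints u n" for p
  proof (rule Bochner_Integration.integrable_bound[OF h])
    show "(\<lambda>x. p x * h x) \<in> borel_measurable M"
      using iterated_midpoints_measurable[OF that meas] h by auto
    show "AE x in M. norm (p x * h x) \<le> norm (h x)"
      using iterated_midpoints_bound[OF that bd] by (auto simp: abs_mult intro!: mult_left_le_one_le)
  qed
  have "(\<integral>x. (f x + g x) / 2 * h x \<partial>M) = (\<integral>x. (f x * h x + g x * h x) / 2 \<partial>M)"
    by (intro Bochner_Integration.integral_cong) (auto simp: algebra_simps)
  also have "\<dots> = ((\<integral>x. f x * h x \<partial>M) + (\<integral>x. g x * h x \<partial>M)) / 2"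
    using int midpoint.hyps by simp
  finally show ?case
    using midpoint.IH unfolding abs_le_iff by (auto simp: field_simps)
qed

text \<open>
  Truncation to \<open>[-c, c]\<close>. If \<open>\<bar>y\<bar> \<le> c + d\<close>, then \<open>y\<close> is the sum of its truncation and a rest bounded
  by \<open>d\<close>, which splits a function dominated by a sum into pieces dominated by the summands.
\<close>

definition clip :: "real \<Rightarrow> real \<Rightarrow> real" where
  "clip c y = max (- c) (min c y)"

lemma abs_clip_le: "0 \<le> c \<Longrightarrow> \<bar>clip c y\<bar> \<le> c"
  and clip_eq: "\<bar>y\<bar> \<le> c \<Longrightarrow> clip c y = y"
  and abs_minus_clip_le: "0 \<le> c \<Longrightarrow> 0 \<le> d \<Longrightarrow> \<bar>y\<bar> \<le> c + d \<Longrightarrow> \<bar>y - clip c y\<bar> \<le> d"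
  by (auto simp: clip_def)

lemma clip_measurable [measurable]:
  assumes [measurable]: "f \<in> borel_measurable M" "g \<in> borel_measurable M"
  shows "(\<lambda>x. clip (f x) (g x)) \<in> borel_measurable M"
  unfolding clip_def by measurable

text \<open>
  Weak sequential compactness of an order interval of \<open>L\<^sup>1\<close>: division by \<open>g\<close> makes the sequence bounded
  by \<open>1\<close>, and the almost everywhere limit of iterated midpoints, multiplied by \<open>g\<close> again, represents
  every limit of integrals by dominated convergence.
\<close>

lemma bounded_density_of_weak_limit:
  fixes c :: "nat \<Rightarrow> 'a::euclidean_space \<Rightarrow> real" and g :: "'a \<Rightarrow> real"
  assumes c: "\<And>j. c j \<in> borel_measurable borel" "\<And>j x. \<bar>c j x\<bar> \<le> g x"
    and g: "g \<in> borel_measurable borel"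
  obtains v where "v \<in> borel_measurable borel" "\<And>x. \<bar>v x\<bar> \<le> g x"
    "\<And>\<phi> l. integrable lborel (\<lambda>x. g x * \<phi> x) \<Longrightarrow>
       (\<lambda>j. \<integral>x. c j x * \<phi> x \<partial>lborel) \<longlonglongrightarrow> l \<Longrightarrow> (\<integral>x. v x * \<phi> x \<partial>lborel) = l"
proof -
  note [measurable] = c(1) g
  have g0: "0 \<le> g x" for x using c(2)[of 0 x] by linarith
  define u where "u j x = c j x / g x" for j x
  have cu: "c j x = u j x * g x" for j x using c(2)[of j x] by (cases "g x = 0") (auto simp: u_def)
  have um: "u j \<in> borel_measurable borel" for j unfolding u_def by measurable
  have ub: "\<bar>u j x\<bar> \<le> 1" for j x
    using c(2)[of j x] g0[of x] by (auto simp: u_def abs_divide divide_le_eq_1)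
  obtain w where w: "\<And>n. w n \<in> iterated_midpoints u n" "AE x in lborel. convergent (\<lambda>n. w n x)"
    by (rule convergent_iterated_midpoints_lborel[of u, OF um ub]) (rule that)
  have wm [measurable]: "w n \<in> borel_measurable borel" for n
    by (rule iterated_midpoints_measurable[OF w(1) um])
  have wb: "\<bar>w n x\<bar> \<le> 1" for n x by (rule iterated_midpoints_bound[OF w(1) ub])
  \<comment> \<open>the truncation only matters where the limit does not exist and \<open>lim\<close> is arbitrary\<close>
  define v where "v x = clip 1 (lim (\<lambda>n. w n x)) * g x" for x
  show ?thesis
  proof (rule that)
    show vm: "v \<in> borel_measurable borel" unfolding v_def by measurable
    show "\<bar>v x\<bar> \<le> g x" for x
      using abs_clip_le[of 1 "lim (\<lambda>n. w n x)"] g0[of x] mult_right_mono[of "\<bar>clip 1 (lim (\<lambda>n. w n x))\<bar>" 1 "g x"]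
      by (simp add: v_def abs_mult)
    fix \<phi> l
    assume i: "integrable lborel (\<lambda>x. g x * \<phi> x)" and l: "(\<lambda>j. \<integral>x. c j x * \<phi> x \<partial>lborel) \<longlonglongrightarrow> l"
    have i': "(\<lambda>x. g x * \<phi> x) \<in> borel_measurable lborel" using i by auto
    have m: "(\<lambda>x. p x * (g x * \<phi> x)) \<in> borel_measurable lborel" if "p \<in> borel_measurable borel" for p
      by (rule borel_measurable_times[OF _ i']) (use that in simp)
    have "(\<lambda>n. \<integral>x. w n x * (g x * \<phi> x) \<partial>lborel) \<longlonglongrightarrow> (\<integral>x. v x * \<phi> x \<partial>lborel)"
    proof (rule integral_dominated_convergence[where w = "\<lambda>x. \<bar>g x * \<phi> x\<bar>"])
      have "(\<lambda>x. clip 1 (lim (\<lambda>n. w n x)) * (g x * \<phi> x)) \<in> borel_measurable lborel"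
        by (rule m) measurable
      then show "(\<lambda>x. v x * \<phi> x) \<in> borel_measurable lborel"
        by (simp add: v_def mult.assoc)
      show "(\<lambda>x. w n x * (g x * \<phi> x)) \<in> borel_measurable lborel" for n by (rule m[OF wm])
      show "integrable lborel (\<lambda>x. \<bar>g x * \<phi> x\<bar>)" using i by (rule integrable_abs)
      show "AE x in lborel. (\<lambda>n. w n x * (g x * \<phi> x)) \<longlonglongrightarrow> v x * \<phi> x"
        using w(2)
      proof eventually_elim
        case (elim x)
        then have lim: "(\<lambda>n. w n x) \<longlonglongrightarrow> lim (\<lambda>n. w n x)" by (simp add: convergent_LIMSEQ_iff)
        have "\<bar>lim (\<lambda>n. w n x)\<bar> \<le> 1"
          by (rule LIMSEQ_le_const2[OF tendsto_rabs[OF lim]]) (use wb in auto)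
        then have "v x = lim (\<lambda>n. w n x) * g x" by (simp add: v_def clip_eq)
        then show ?case using tendsto_mult[OF lim tendsto_const[of "g x * \<phi> x"]] by (simp add: mult.assoc)
      qed
      show "AE x in lborel. norm (w n x * (g x * \<phi> x)) \<le> \<bar>g x * \<phi> x\<bar>" for n
        using wb[of n] by (intro AE_I2) (auto simp: abs_mult intro!: mult_left_le_one_le)
    qed
    moreover have "(\<lambda>n. \<integral>x. w n x * (g x * \<phi> x) \<partial>lborel) \<longlonglongrightarrow> l"
    proof (rule metric_LIMSEQ_I)
      fix r :: real assume "r > 0"
      then obtain n0 where n0: "\<And>j. j \<ge> n0 \<Longrightarrow> \<bar>(\<integral>x. c j x * \<phi> x \<partial>lborel) - l\<bar> < r / 2"
        using metric_LIMSEQ_D[OF l, of "r / 2"] by (auto simp: dist_real_def)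
      have "\<bar>(\<integral>x. w n x * (g x * \<phi> x) \<partial>lborel) - l\<bar> \<le> r / 2" if "n \<ge> n0" for n
        by (rule iterated_midpoints_functional_bound[OF w(1)[of n] _ ub i])
          (use um n0 that in \<open>auto simp: cu mult.assoc intro: less_imp_le order_trans\<close>)
      then show "\<exists>no. \<forall>n\<ge>no. dist (\<integral>x. w n x * (g x * \<phi> x) \<partial>lborel) l < r"
        using \<open>r > 0\<close> by (intro exI[of _ n0]) (force simp: dist_real_def)
    qed
    ultimately show "(\<integral>x. v x * \<phi> x \<partial>lborel) = l" by (rule LIMSEQ_unique)
  qed
qed

text \<open>
  Near the support of a test function and for large \<open>j\<close>, the difference quotients \<open>D j\<close> in direction
  \<open>e = axis k 1\<close> satisfy \<open>\<bar>D j x\<bar> \<le> g x + g (x + \<tau> j e)\<close> almost everywhere. The second summand depends on \<open>j\<close>, so they are not dominated by one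
  function. Truncating \<open>D j\<close> at \<open>g x\<close> leaves a rest \<open>b j\<close> bounded by \<open>g (x + \<tau> j e)\<close>; shifting the
  rest back by \<open>\<tau> j e\<close> makes it bounded by \<open>g x\<close> and changes its integral against a test function only
  by \<open>O(\<tau> j)\<close>, since test functions are Lipschitz. The resulting functions \<open>c j\<close> are dominated by
  \<open>2 g\<close> and have the weak limit of the difference quotients, so a density bounded by \<open>2 g\<close> exists.
\<close>

lemma weak_partial_derivative_exists:
  fixes f g :: "real^'n \<Rightarrow> real" and k :: 'n
  assumes \<Omega>: "open \<Omega>"
    and f: "f \<in> borel_measurable borel" "\<And>K. compact K \<Longrightarrow> K \<subseteq> \<Omega> \<Longrightarrow> set_integrable lborel K f"
    and g: "g \<in> borel_measurable borel" "\<And>K. compact K \<Longrightarrow> K \<subseteq> \<Omega> \<Longrightarrow> set_integrable lborel K g" "\<And>x. 0 \<le> g x"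
    and G: "AE x in lborel. x \<in> G"
    and ineq: "\<And>x y. x \<in> G \<Longrightarrow> y \<in> G \<Longrightarrow> ball x (3 * dist x y) \<subseteq> \<Omega> \<Longrightarrow> x \<in> \<Omega> \<Longrightarrow> y \<in> \<Omega> \<Longrightarrow>
      \<bar>f x - f y\<bar> \<le> dist x y * (g x + g y)"
  obtains v where "v \<in> borel_measurable borel" "\<And>x. \<bar>v x\<bar> \<le> 2 * g x"
    "\<And>\<phi>. \<phi> \<in> test_functions \<Omega> \<Longrightarrow>
      (\<integral>x. f x * partial_derivative k \<phi> x \<partial>lborel) = - (\<integral>x. v x * \<phi> x \<partial>lborel)"
proof -
  note [measurable] = f(1) g(1)
  define e where "e = (axis k 1 :: real^'n)"
  have ne: "norm e = 1" by (simp add: e_def)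
  define \<tau> where "\<tau> j = inverse (real (Suc j))" for j
  have \<tau>: "\<tau> j > 0" for j by (simp add: \<tau>_def)
  have \<tau>0: "\<tau> \<longlonglongrightarrow> 0" unfolding \<tau>_def by (rule LIMSEQ_inverse_real_of_nat)
  define D where "D j x = (f (x + \<tau> j *\<^sub>R e) - f x) / \<tau> j" for j x
  define a where "a j x = clip (g x) (D j x)" for j x
  define b where "b j x = D j x - a j x" for j x
  define bt where "bt j x = clip (g x) (b j (x - \<tau> j *\<^sub>R e))" for j x
  define c where "c j x = a j x + bt j x" for j x
  have Dm [measurable]: "D j \<in> borel_measurable borel" for j unfolding D_def by measurable
  have am [measurable]: "a j \<in> borel_measurable borel" for j unfolding a_def by measurable
  have bm [measurable]: "b j \<in> borel_measurable borel" for j unfolding b_def by measurable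
  have btm [measurable]: "bt j \<in> borel_measurable borel" for j unfolding bt_def by measurable
  have cm [measurable]: "c j \<in> borel_measurable borel" for j unfolding c_def by measurable
  have ab: "\<bar>a j x\<bar> \<le> g x" "\<bar>bt j x\<bar> \<le> g x" for j x
    unfolding a_def bt_def by (intro abs_clip_le g(3))+
  have cb: "\<bar>c j x\<bar> \<le> 2 * g x" for j x
    using ab[of j x] unfolding c_def by linarith
  obtain v where v: "v \<in> borel_measurable borel" "\<And>x. \<bar>v x\<bar> \<le> 2 * g x"
    "\<And>\<phi> l. integrable lborel (\<lambda>x. (2 * g x) * \<phi> x) \<Longrightarrow>
       (\<lambda>j. \<integral>x. c j x * \<phi> x \<partial>lborel) \<longlonglongrightarrow> l \<Longrightarrow> (\<integral>x. v x * \<phi> x \<partial>lborel) = l"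
    by (rule bounded_density_of_weak_limit[of c "\<lambda>x. 2 * g x"]) (use cm cb in auto)
  show ?thesis
  proof (rule that[OF v(1,2)])
    fix \<phi> assume \<phi>: "\<phi> \<in> test_functions \<Omega>"
    note [measurable] = test_function_measurable[OF \<phi>]
    obtain B where B: "B \<ge> 0" "\<And>x. \<bar>\<phi> x\<bar> \<le> B" using test_function_bounded[OF \<phi>] by blast
    obtain L where L: "L \<ge> 0" "\<And>x y. \<bar>\<phi> x - \<phi> y\<bar> \<le> L * norm (x - y)" using test_function_Lipschitz[OF \<phi>] by blast
    define K where "K = closure {x. \<phi> x \<noteq> 0}"
    have K: "compact K" "K \<subseteq> \<Omega>" using test_function_compact_support[OF \<phi>] by (simp_all add: K_def)
    have supp: "x \<in> K" if "\<phi> x \<noteq> 0" for x using that closure_subset[of "{x. \<phi> x \<noteq> 0}"] by (auto simp: K_def)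
    obtain \<epsilon> where \<epsilon>: "\<epsilon> > 0" "(\<Union>x\<in>K. ball x \<epsilon>) \<subseteq> \<Omega>"
      using compact_subset_open_imp_ball_epsilon_subset[OF K(1) \<Omega> K(2)] by blast
    \<comment> \<open>for steps of length at most \<open>\<epsilon> / 4\<close> the balls of three times the step around
      points of \<open>K\<close> stay in \<open>\<Omega>\<close>\<close>
    define \<delta> where "\<delta> = \<epsilon> / 4"
    have \<delta>: "\<delta> > 0" using \<epsilon> by (simp add: \<delta>_def)
    define K1 where "K1 = {x + y | x y. x \<in> K \<and> y \<in> cball 0 \<delta>}"
    have K1: "compact K1" "K1 \<subseteq> \<Omega>"
    proof -
      show "compact K1" unfolding K1_def by (rule compact_sums[OF K(1) compact_cball])
      show "K1 \<subseteq> \<Omega>"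
      proof
        fix z assume "z \<in> K1"
        then obtain x y where "z = x + y" "x \<in> K" "norm y \<le> \<delta>" by (auto simp: K1_def)
        then have "z \<in> ball x \<epsilon>" using \<epsilon>(1) by (simp add: dist_norm \<delta>_def)
        then show "z \<in> \<Omega>" using \<epsilon>(2) \<open>x \<in> K\<close> by blast
      qed
    qed
    have shift: "x \<in> K1" if "x - s *\<^sub>R e \<in> K" "\<bar>s\<bar> \<le> \<delta>" for x s
      unfolding K1_def mem_Collect_eq
      by (rule exI[of _ "x - s *\<^sub>R e"], rule exI[of _ "s *\<^sub>R e"]) (use that ne in auto)
    have KK1: "K \<subseteq> K1" using shift[of _ 0] \<delta> by auto
    note fK1 = f(2)[OF K1] and gK1 = g(2)[OF K1]
    define F where "F s = (\<integral>x. f x * \<phi> (x - s *\<^sub>R e) \<partial>lborel)" for s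
    define l where "l = - (\<integral>x. f x * partial_derivative k \<phi> x \<partial>lborel)"
    have intf: "integrable lborel (\<lambda>x. f x * \<phi> (x - s *\<^sub>R e))" if "\<bar>s\<bar> \<le> \<delta>" for s
      by (rule integrable_mult_bounded_support[OF fK1 f(1), where B = B])
        (use B shift[OF supp that] in auto)
    have intg: "integrable lborel (\<lambda>x. g x * \<phi> (x - s *\<^sub>R e))" if "\<bar>s\<bar> \<le> \<delta>" for s
      by (rule integrable_mult_bounded_support[OF gK1 g(1), where B = B])
        (use B shift[OF supp that] in auto)
    have intp: "integrable lborel (\<lambda>x. p x * \<phi> (x - s *\<^sub>R e))"
      if "\<bar>s\<bar> \<le> \<delta>" "p \<in> borel_measurable borel" "\<And>x. \<bar>p x\<bar> \<le> g x" for s p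
      by (rule Bochner_Integration.integrable_bound[OF intg[OF that(1)]])
        (use that(2,3) g(3) in \<open>auto simp: abs_mult intro!: mult_right_mono\<close>)
    have "(F has_real_derivative l) (at 0 within {0..\<delta>})"
    proof -
      have "((\<lambda>s. \<integral>x. f x * \<phi> (x - s *\<^sub>R e) \<partial>lborel) has_real_derivative
          - (\<integral>x. f x * (\<Sum>i\<in>UNIV. e $ i * partial_derivative i \<phi> (x - 0 *\<^sub>R e)) \<partial>lborel)) (at 0 within {0..\<delta>})"
        by (rule translated_integral_has_derivative[OF f(1) fK1 \<phi>]) (use \<delta> in \<open>auto intro!: shift[OF supp]\<close>)
      moreover have "(\<Sum>i\<in>UNIV. e $ i * partial_derivative i \<phi> (x - 0 *\<^sub>R e)) = partial_derivative k \<phi> x" for x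
        by (simp add: e_def axis_def if_distrib[of "\<lambda>c. c * _"] cong: if_cong)
      ultimately show ?thesis unfolding F_def l_def by simp
    qed
    then have Fl: "((\<lambda>s. (F s - F 0) / s) \<longlongrightarrow> l) (at 0 within {0..\<delta>})"
      by (simp add: has_field_derivative_iff)
    obtain N where N: "\<And>j. j \<ge> N \<Longrightarrow> \<tau> j \<le> \<delta>"
    proof -
      have "eventually (\<lambda>j. \<tau> j < \<delta>) sequentially" using \<tau>0 \<delta> by (rule order_tendstoD)
      then show ?thesis using that by (auto simp: eventually_sequentially intro: less_imp_le)
    qed
    have "(\<lambda>j. (F (\<tau> (j + N)) - F 0) / \<tau> (j + N)) \<longlonglongrightarrow> l"
    proof -
      have "\<forall>i. \<tau> (i + N) \<in> {0..\<delta>} - {0}" using \<tau> N by (auto simp: less_imp_le less_imp_neq[THEN not_sym])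
      moreover have "(\<lambda>i. \<tau> (i + N)) \<longlonglongrightarrow> 0" using \<tau>0 by (rule LIMSEQ_ignore_initial_segment)
      ultimately show ?thesis
        by (rule Fl[unfolded tendsto_at_iff_sequentially comp_def, THEN spec, THEN mp, THEN mp])
    qed
    then have quot: "(\<lambda>j. (F (\<tau> j) - F 0) / \<tau> j) \<longlonglongrightarrow> l" by (rule LIMSEQ_offset)
    define I where "I = (\<integral>x. \<bar>indicator K1 x *\<^sub>R g x\<bar> \<partial>lborel)"
    have est: "\<bar>(\<integral>x. c j x * \<phi> x \<partial>lborel) - (F (\<tau> j) - F 0) / \<tau> j\<bar> \<le> L * \<tau> j * I" if "j \<ge> N" for j
    proof -
      have tj: "\<tau> j \<le> \<delta>" "\<bar>\<tau> j\<bar> \<le> \<delta>" "\<bar>0::real\<bar> \<le> \<delta>" using N[OF that] \<tau>[of j] \<delta> by auto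
      have bK: "AE x in lborel. x \<in> K \<longrightarrow> \<bar>b j x\<bar> \<le> g (x + \<tau> j *\<^sub>R e)"
        using G AE_lborel_translate[OF G, of "\<tau> j *\<^sub>R e"]
      proof eventually_elim
        case (elim x)
        show ?case
        proof
          assume x: "x \<in> K"
          let ?y = "x + \<tau> j *\<^sub>R e"
          have d: "dist x ?y = \<tau> j" using \<tau>[of j] ne by (simp add: dist_norm)
          have "ball x (3 * \<tau> j) \<subseteq> ball x \<epsilon>" using tj \<tau>[of j] by (intro subset_ball) (simp add: \<delta>_def)
          then have sub: "ball x (3 * dist x ?y) \<subseteq> \<Omega>" using \<epsilon>(2) x d by auto
          have y: "?y \<in> ball x (3 * dist x ?y)" using d \<tau>[of j] by simp
          then have "\<bar>f x - f ?y\<bar> \<le> \<tau> j * (g x + g ?y)"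
            using ineq[OF elim sub] subsetD[OF sub y] subsetD[OF K(2) x] d by simp
          then have "\<bar>D j x\<bar> \<le> g x + g ?y"
            using \<tau>[of j] by (simp add: D_def abs_divide abs_minus_commute pos_divide_le_eq mult.commute)
          then show "\<bar>b j x\<bar> \<le> g ?y"
            unfolding b_def a_def using g(3) by (intro abs_minus_clip_le)
        qed
      qed
      \<comment> \<open>on the support of the shifted test function the second truncation has no effect\<close>
      have bt: "AE x in lborel. b j (x - \<tau> j *\<^sub>R e) * \<phi> (x - \<tau> j *\<^sub>R e) = bt j x * \<phi> (x - \<tau> j *\<^sub>R e)"
        using AE_lborel_translate[OF bK, of "- \<tau> j *\<^sub>R e"]
      proof eventually_elim
        case (elim x)
        then show ?case
          using supp[of "x - \<tau> j *\<^sub>R e"] by (cases "\<phi> (x - \<tau> j *\<^sub>R e) = 0") (auto simp: bt_def clip_eq)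
      qed
      have ia: "integrable lborel (\<lambda>x. a j x * \<phi> x)" "integrable lborel (\<lambda>x. bt j x * \<phi> x)"
        "integrable lborel (\<lambda>x. bt j x * \<phi> (x - \<tau> j *\<^sub>R e))"
        using intp[OF tj(3) am ab(1)] intp[OF tj(3) btm ab(2)] intp[OF tj(2) btm ab(2)] by simp_all
      have if1: "integrable lborel (\<lambda>x. f (x + \<tau> j *\<^sub>R e) * \<phi> x)"
        using integrable_lborel_translate[OF intf[OF tj(2)], of "\<tau> j *\<^sub>R e"] by simp
      have if0: "integrable lborel (\<lambda>x. f x * \<phi> x)" using intf[OF tj(3)] by simp
      have Dq: "D j x * \<phi> x = (f (x + \<tau> j *\<^sub>R e) * \<phi> x - f x * \<phi> x) / \<tau> j" for x
        by (simp add: D_def left_diff_distrib)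
      have iD: "integrable lborel (\<lambda>x. D j x * \<phi> x)"
        unfolding Dq using if1 if0 by auto
      have ib: "integrable lborel (\<lambda>x. b j x * \<phi> x)"
        unfolding b_def left_diff_distrib using iD ia(1) by auto
      have "F (\<tau> j) = (\<integral>x. f (x + \<tau> j *\<^sub>R e) * \<phi> x \<partial>lborel)"
        using integral_lborel_translate[of "\<lambda>x. f x * \<phi> (x - \<tau> j *\<^sub>R e)" "\<tau> j *\<^sub>R e"] by (simp add: F_def)
      then have "(F (\<tau> j) - F 0) / \<tau> j = (\<integral>x. D j x * \<phi> x \<partial>lborel)"
        unfolding Dq F_def using if1 if0 by simp
      also have "\<dots> = (\<integral>x. a j x * \<phi> x + b j x * \<phi> x \<partial>lborel)"
        by (simp add: b_def algebra_simps)
      also have "\<dots> = (\<integral>x. a j x * \<phi> x \<partial>lborel) + (\<integral>x. b j x * \<phi> x \<partial>lborel)"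
        using ia ib by simp
      also have "(\<integral>x. b j x * \<phi> x \<partial>lborel) = (\<integral>x. b j (x - \<tau> j *\<^sub>R e) * \<phi> (x - \<tau> j *\<^sub>R e) \<partial>lborel)"
        using integral_lborel_translate[of "\<lambda>x. b j x * \<phi> x" "- \<tau> j *\<^sub>R e"] by simp
      also have "\<dots> = (\<integral>x. bt j x * \<phi> (x - \<tau> j *\<^sub>R e) \<partial>lborel)"
        by (rule integral_cong_AE[OF _ _ bt]) measurable
      finally have q: "(F (\<tau> j) - F 0) / \<tau> j =
        (\<integral>x. a j x * \<phi> x \<partial>lborel) + (\<integral>x. bt j x * \<phi> (x - \<tau> j *\<^sub>R e) \<partial>lborel)" .
      have "(\<integral>x. c j x * \<phi> x \<partial>lborel) = (\<integral>x. a j x * \<phi> x \<partial>lborel) + (\<integral>x. bt j x * \<phi> x \<partial>lborel)"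
        unfolding c_def distrib_right using ia by simp
      with q have "(\<integral>x. c j x * \<phi> x \<partial>lborel) - (F (\<tau> j) - F 0) / \<tau> j =
          (\<integral>x. bt j x * \<phi> x - bt j x * \<phi> (x - \<tau> j *\<^sub>R e) \<partial>lborel)"
        using ia by simp
      also have "\<bar>\<dots>\<bar> \<le> (\<integral>x. (L * \<tau> j) * \<bar>indicator K1 x *\<^sub>R g x\<bar> \<partial>lborel)"
      proof (rule order_trans[OF integral_abs_bound], rule integral_mono)
        show "integrable lborel (\<lambda>x. (L * \<tau> j) * \<bar>indicator K1 x *\<^sub>R g x\<bar>)"
          using gK1 unfolding set_integrable_def by (intro integrable_mult_right integrable_abs)
        show "integrable lborel (\<lambda>x. \<bar>bt j x * \<phi> x - bt j x * \<phi> (x - \<tau> j *\<^sub>R e)\<bar>)"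
          using ia by (intro integrable_abs Bochner_Integration.integrable_diff)
        fix x
        have "\<bar>bt j x * \<phi> x - bt j x * \<phi> (x - \<tau> j *\<^sub>R e)\<bar> = \<bar>\<phi> x - \<phi> (x - \<tau> j *\<^sub>R e)\<bar> * \<bar>bt j x\<bar>"
          by (subst abs_mult[symmetric]) (simp add: algebra_simps)
        also have "\<dots> \<le> (L * \<tau> j) * \<bar>indicator K1 x *\<^sub>R g x\<bar>"
        proof (cases "x \<in> K1")
          case True
          have "\<bar>\<phi> x - \<phi> (x - \<tau> j *\<^sub>R e)\<bar> \<le> L * \<tau> j"
            using L(2)[of x "x - \<tau> j *\<^sub>R e"] \<tau>[of j] ne by simp
          then show ?thesis
            using True ab(2)[of j x] g(3)[of x] L(1) \<tau>[of j] by (intro mult_mono) auto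
        next
          case False
          then have "\<phi> x = 0" "\<phi> (x - \<tau> j *\<^sub>R e) = 0" using KK1 supp shift tj by blast+
          then show ?thesis using L(1) \<tau>[of j] by simp
        qed
        finally show "\<bar>bt j x * \<phi> x - bt j x * \<phi> (x - \<tau> j *\<^sub>R e)\<bar> \<le> (L * \<tau> j) * \<bar>indicator K1 x *\<^sub>R g x\<bar>" .
      qed
      also have "\<dots> = L * \<tau> j * I" unfolding I_def by simp
      finally show ?thesis .
    qed
    have "(\<lambda>j. L * \<tau> j * I) \<longlonglongrightarrow> L * 0 * I" by (intro tendsto_intros \<tau>0)
    then have "(\<lambda>j. L * \<tau> j * I) \<longlonglongrightarrow> 0" by simp
    then have "(\<lambda>j. (\<integral>x. c j x * \<phi> x \<partial>lborel) - (F (\<tau> j) - F 0) / \<tau> j) \<longlonglongrightarrow> 0"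
      by (rule Lim_null_comparison[rotated])
        (use est in \<open>auto simp: eventually_sequentially\<close>)
    from tendsto_add[OF this quot] have "(\<lambda>j. \<integral>x. c j x * \<phi> x \<partial>lborel) \<longlonglongrightarrow> l" by simp
    moreover have "integrable lborel (\<lambda>x. (2 * g x) * \<phi> x)"
      using intg[of 0] \<delta> by (simp add: mult.assoc)
    ultimately have "(\<integral>x. v x * \<phi> x \<partial>lborel) = l" by (intro v(3))
    then show "(\<integral>x. f x * partial_derivative k \<phi> x \<partial>lborel) = - (\<integral>x. v x * \<phi> x \<partial>lborel)"
      by (simp add: l_def)
  qed
qed

section \<open>Translation differences and the weak gradient\<close>

lemma partial_derivative_translate:
  assumes "\<phi> \<in> test_functions \<Omega>"
  shows "partial_derivative k (\<lambda>x. \<phi> (x - u)) x = partial_derivative k \<phi> (x - u)"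
proof -
  have "((\<lambda>x. \<phi> (x - u)) has_derivative (\<lambda>v. \<Sum>k\<in>UNIV. v $ k * partial_derivative k \<phi> (x - u))) (at x)"
    by (rule has_derivative_compose[where g = \<phi> and f = "\<lambda>x. x - u", OF _ test_function_has_derivative[OF assms]])
      (auto intro!: derivative_eq_intros)
  then have "frechet_derivative (\<lambda>x. \<phi> (x - u)) (at x) = (\<lambda>v. \<Sum>k\<in>UNIV. v $ k * partial_derivative k \<phi> (x - u))"
    by (rule frechet_derivative_at[symmetric])
  then show ?thesis
    by (simp add: partial_derivative_def[of k "\<lambda>x. \<phi> (x - u)"] axis_def if_distrib[of "\<lambda>c. c * _"] cong: if_cong)
qed

lemma open_cball_subset:
  fixes \<Omega> :: "'a::euclidean_space set"
  assumes "open \<Omega>"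
  shows "open {p. cball p r \<subseteq> \<Omega>}"
  unfolding open_contains_ball
proof
  fix p assume "p \<in> {p. cball p r \<subseteq> \<Omega>}"
  then obtain \<epsilon> where \<epsilon>: "\<epsilon> > 0" "(\<Union>x\<in>cball p r. ball x \<epsilon>) \<subseteq> \<Omega>"
    using compact_subset_open_imp_ball_epsilon_subset[OF compact_cball assms] by blast
  have "cball q r \<subseteq> \<Omega>" if q: "q \<in> ball p \<epsilon>" for q
  proof
    fix y assume "y \<in> cball q r"
    then have "y - q + p \<in> cball p r" by (simp add: dist_norm norm_minus_commute)
    moreover have "y \<in> ball (y - q + p) \<epsilon>" using q by (simp add: dist_norm)
    ultimately show "y \<in> \<Omega>" using \<epsilon>(2) by blast
  qed
  then show "\<exists>e>0. ball p e \<subseteq> {p. cball p r \<subseteq> \<Omega>}" using \<epsilon>(1) by blast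
qed

lemma nn_integral_lborel_translate:
  fixes u :: "'a::euclidean_space"
  assumes "h \<in> borel_measurable borel"
  shows "(\<integral>\<^sup>+x. h (x + u) \<partial>lborel) = (\<integral>\<^sup>+x. h x \<partial>lborel)"
  using nn_integral_distr[of "(+) u" lborel borel h] assms by (simp add: lborel_distr_plus add.commute)

text \<open>
  The fundamental theorem of calculus for a weak gradient. For a box bump \<open>\<psi>\<close> the function
  \<open>F s = \<integral> f(x) \<psi>(x - s v) dx\<close> has derivative \<open>\<integral> (G(x) \<bullet> v) \<psi>(x - s v) dx\<close>, because the translated
  bump is a test function. Integrating over \<open>[0, 1]\<close> and exchanging the integrals shows that both
  sides of the identity have the same integral against \<open>\<psi>\<close>. The bumps tend to indicators of boxes, and
  a function with vanishing integrals over boxes vanishes almost everywhere.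
\<close>

lemma AE_translation_difference_eq:
  fixes f :: "real^'n \<Rightarrow> real" and G :: "real^'n \<Rightarrow> real^'n"
  assumes \<Omega>: "open \<Omega>"
    and f: "f \<in> borel_measurable borel" "\<And>K. compact K \<Longrightarrow> K \<subseteq> \<Omega> \<Longrightarrow> set_integrable lborel K f"
    and G: "G \<in> borel_measurable borel" "\<And>K k. compact K \<Longrightarrow> K \<subseteq> \<Omega> \<Longrightarrow> set_integrable lborel K (\<lambda>x. G x $ k)"
    and weak: "\<And>\<phi> k. \<phi> \<in> test_functions \<Omega> \<Longrightarrow>
      (\<integral>x. f x * partial_derivative k \<phi> x \<partial>lborel) = - (\<integral>x. G x $ k * \<phi> x \<partial>lborel)"
  shows "AE p in lborel. cball p (norm v) \<subseteq> \<Omega> \<longrightarrow>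
    f (p + v) - f p = (\<integral>t. indicator {0..1} t * (G (p + t *\<^sub>R v) \<bullet> v) \<partial>lborel)"
proof -
  note [measurable] = f(1) G(1)
  define Gv where "Gv x = G x \<bullet> v" for x
  have Gv_m [measurable]: "Gv \<in> borel_measurable borel" unfolding Gv_def by measurable
  have Gv_sum: "Gv x = (\<Sum>k\<in>UNIV. v $ k * G x $ k)" for x
    by (simp add: Gv_def inner_vec_def mult.commute)
  have Gk: "(\<lambda>x. G x $ k) \<in> borel_measurable borel" for k
    unfolding cart_eq_inner_axis by measurable
  define J where "J p = (\<integral>t. indicator {0..1} t * Gv (p + t *\<^sub>R v) \<partial>lborel)" for p
  have J_m [measurable]: "J \<in> borel_measurable borel" unfolding J_def by measurable
  define w where "w p = f (p + v) - f p - J p" for p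
  let ?U = "{p. cball p (norm v) \<subseteq> \<Omega>}"
  have box: "AE p in lborel. p \<in> cbox a b \<longrightarrow> w p = 0" if ab: "cbox a b \<subseteq> ?U" for a b
  proof -
    define K where "K = (\<lambda>(p, t). p + t *\<^sub>R v) ` (cbox a b \<times> {0..1})"
    have K: "compact K" unfolding K_def
      by (intro compact_continuous_image compact_Times compact_cbox compact_Icc)
        (auto intro!: continuous_intros simp: case_prod_unfold)
    have KI: "p + t *\<^sub>R v \<in> K" if "p \<in> cbox a b" "0 \<le> t" "t \<le> 1" for p t
      unfolding K_def using that by force
    have "K \<subseteq> \<Omega>"
    proof
      fix x assume "x \<in> K"
      then obtain p t where x: "x = p + t *\<^sub>R v" "p \<in> cbox a b" "0 \<le> t" "t \<le> 1" by (auto simp: K_def)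
      have "norm (t *\<^sub>R v) \<le> norm v" using x(3,4) by (simp add: mult_left_le_one_le)
      then have "x \<in> cball p (norm v)" using x(1) by (simp add: dist_norm)
      then show "x \<in> \<Omega>" using ab x(2) by blast
    qed
    have [measurable]: "K \<in> sets borel" using K by (simp add: borel_compact)
    note fK = f(2)[OF K \<open>K \<subseteq> \<Omega>\<close>]
    have abK: "cbox a b \<subseteq> K" using KI[of _ 0] by auto
    have GvK: "set_integrable lborel K Gv"
      unfolding set_integrable_def Gv_sum scaleR_sum_right
      using G(2)[OF K \<open>K \<subseteq> \<Omega>\<close>] unfolding set_integrable_def
      by (intro Bochner_Integration.integrable_sum) (simp add: mult.left_commute)
    \<comment> \<open>integrable on the product since every translate of the box by \<open>t v\<close> lies in \<open>K\<close>\<close>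
    define H where "H = (\<lambda>(t, p). indicator {0..1::real} t * indicator (cbox a b) p * Gv (p + t *\<^sub>R v))"
    have H_int: "integrable (lborel \<Otimes>\<^sub>M lborel) H"
    proof (rule integrableI_bounded)
      show [measurable]: "H \<in> borel_measurable (lborel \<Otimes>\<^sub>M lborel)" unfolding H_def by measurable
      define C where "C = (\<integral>\<^sup>+x. ennreal (norm (indicator K x *\<^sub>R Gv x)) \<partial>lborel)"
      have C: "C < \<infinity>" using GvK unfolding C_def set_integrable_def integrable_iff_bounded by blast
      have inner: "(\<integral>\<^sup>+p. ennreal (norm (H (t, p))) \<partial>lborel) \<le> C * indicator {0..1} t" for t
      proof (cases "t \<in> {0..1}")
        case True
        have "(\<integral>\<^sup>+p. ennreal (norm (H (t, p))) \<partial>lborel)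
            \<le> (\<integral>\<^sup>+p. ennreal (norm (indicator K (p + t *\<^sub>R v) *\<^sub>R Gv (p + t *\<^sub>R v))) \<partial>lborel)"
          using True KI by (intro nn_integral_mono) (auto simp: H_def split: split_indicator)
        also have "\<dots> = C"
          unfolding C_def by (rule nn_integral_lborel_translate) measurable
        finally show ?thesis using True by simp
      qed (simp add: H_def)
      have "(\<integral>\<^sup>+z. ennreal (norm (H z)) \<partial>(lborel \<Otimes>\<^sub>M lborel)) = (\<integral>\<^sup>+t. \<integral>\<^sup>+p. ennreal (norm (H (t, p))) \<partial>lborel \<partial>lborel)"
        by (subst lborel.nn_integral_fst[symmetric]) auto
      also have "\<dots> \<le> (\<integral>\<^sup>+t. C * indicator {0..1::real} t \<partial>lborel)"
        by (intro nn_integral_mono inner)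
      also have "\<dots> = C" by (simp add: nn_integral_cmult_indicator)
      finally show "(\<integral>\<^sup>+z. ennreal (norm (H z)) \<partial>(lborel \<Otimes>\<^sub>M lborel)) < \<infinity>" using C by simp
    qed
    have HJ: "(\<integral>t. H (t, p) \<partial>lborel) = indicator (cbox a b) p * J p" for p
      by (cases "p \<in> cbox a b") (simp_all add: H_def J_def)
    have J_int: "set_integrable lborel (cbox a b) J"
      unfolding set_integrable_def using lborel_pair.integrable_snd[of "\<lambda>t p. H (t, p)"] H_int HJ by simp
    have fv_int: "set_integrable lborel (cbox a b) (\<lambda>p. f (p + v))"
    proof -
      have "integrable lborel (\<lambda>x. f x * indicator (cbox a b) (x - v))"
        by (rule integrable_mult_bounded_support[OF fK f(1), where B = 1])
          (use KI[of "_ - v" 1] in \<open>auto split: split_indicator_asm split_indicator\<close>)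
      from integrable_lborel_translate[OF this, of v] show ?thesis
        by (simp add: set_integrable_def mult.commute)
    qed
    have w_int: "set_integrable lborel (cbox a b) w"
      unfolding w_def using J_int fv_int set_integrable_subset[OF fK _ abK]
      by (intro set_integral_diff) auto
    show ?thesis
    proof (rule AE_zero_if_box_integrals_zero[OF w_int])
      fix c d assume cd: "cbox c d \<subseteq> cbox a b"
      have zero: "(\<integral>p. w p * box_bump m c d p \<partial>lborel) = 0" for m
      proof -
        define \<psi> where "\<psi> = (box_bump m c d :: real^'n \<Rightarrow> real)"
        have \<psi>0: "x \<in> cbox a b" if "\<psi> x \<noteq> 0" for x
          using that cd box_subset_cbox[of c d] unfolding \<psi>_def box_bump_eq_0_iff by blast
        have \<psi>1: "\<bar>\<psi> x\<bar> \<le> 1" for x using box_bump_bounds[of m c d x] by (simp add: \<psi>_def)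
        have \<psi>t: "(\<lambda>x. \<psi> (x - t *\<^sub>R v)) \<in> test_functions \<Omega>" if t: "0 \<le> t" "t \<le> 1" for t
        proof -
          have "cbox (c + t *\<^sub>R v) (d + t *\<^sub>R v) \<subseteq> \<Omega>"
          proof
            fix x assume "x \<in> cbox (c + t *\<^sub>R v) (d + t *\<^sub>R v)"
            then have "x - t *\<^sub>R v \<in> cbox c d" by (auto simp: mem_box_cart algebra_simps)
            then have "x \<in> K" using KI[of "x - t *\<^sub>R v" t] cd t by auto
            then show "x \<in> \<Omega>" using \<open>K \<subseteq> \<Omega>\<close> by auto
          qed
          then show ?thesis unfolding \<psi>_def box_bump_translate by (rule box_bump_test_function)
        qed
        have \<psi>: "\<psi> \<in> test_functions \<Omega>" using \<psi>t[of 0] by simp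
        note [measurable] = test_function_measurable[OF \<psi>]
        have suppK: "x \<in> K" if "\<psi> (x - t *\<^sub>R v) \<noteq> 0" "0 \<le> t" "t \<le> 1" for x t
          using KI[OF \<psi>0[OF that(1)] that(2,3)] by simp
        have pK: "integrable lborel (\<lambda>x. p x * \<psi> (x - t *\<^sub>R v))"
          if "set_integrable lborel K p" "p \<in> borel_measurable borel" "0 \<le> t" "t \<le> 1" for p t
          by (rule integrable_mult_bounded_support[OF that(1,2), where B = 1]) (use \<psi>1 suppK that in auto)
        define F where "F s = (\<integral>x. f x * \<psi> (x - s *\<^sub>R v) \<partial>lborel)" for s
        define g where "g s = (\<integral>p. Gv (p + s *\<^sub>R v) * \<psi> p \<partial>lborel)" for s
        have deriv: "(F has_real_derivative g t) (at t within {0..1})" if t: "t \<in> {0..1}" for t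
        proof -
          have t': "0 \<le> t" "t \<le> 1" using t by auto
          let ?\<phi> = "\<lambda>x. \<psi> (x - t *\<^sub>R v)"
          have d: "(F has_real_derivative
              - (\<integral>x. f x * (\<Sum>k\<in>UNIV. v $ k * partial_derivative k \<psi> (x - t *\<^sub>R v)) \<partial>lborel)) (at t within {0..1})"
            unfolding F_def
            by (rule translated_integral_has_derivative[OF f(1) fK \<psi> t]) (use suppK in auto)
          have fd: "integrable lborel (\<lambda>x. f x * partial_derivative k ?\<phi> x)" for k
          proof -
            obtain B where B: "\<And>x. \<bar>partial_derivative k ?\<phi> x\<bar> \<le> B"
              using partial_derivative_bounded[OF \<psi>t[OF t'], of k] by auto
            have "{x. ?\<phi> x \<noteq> 0} \<subseteq> K" using suppK t' by blast
            then have "closure {x. ?\<phi> x \<noteq> 0} \<subseteq> K" using K by (intro closure_minimal compact_imp_closed)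
            then show ?thesis
              using partial_derivative_support[of k ?\<phi>]
              by (intro integrable_mult_bounded_support[OF fK f(1) test_function_measurable(2)[OF \<psi>t[OF t']] B]) blast
          qed
          have "(\<integral>x. f x * (\<Sum>k\<in>UNIV. v $ k * partial_derivative k \<psi> (x - t *\<^sub>R v)) \<partial>lborel)
              = (\<integral>x. (\<Sum>k\<in>UNIV. v $ k * (f x * partial_derivative k ?\<phi> x)) \<partial>lborel)"
            by (simp add: partial_derivative_translate[OF \<psi>] sum_distrib_left mult.left_commute)
          also have "\<dots> = (\<Sum>k\<in>UNIV. v $ k * (\<integral>x. f x * partial_derivative k ?\<phi> x \<partial>lborel))"
            using fd by (subst Bochner_Integration.integral_sum) auto
          also have "\<dots> = - (\<Sum>k\<in>UNIV. v $ k * (\<integral>x. G x $ k * ?\<phi> x \<partial>lborel))"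
            using weak[OF \<psi>t[OF t']] by (simp add: sum_negf)
          also have "(\<Sum>k\<in>UNIV. v $ k * (\<integral>x. G x $ k * ?\<phi> x \<partial>lborel)) = (\<integral>x. (\<Sum>k\<in>UNIV. v $ k * (G x $ k * ?\<phi> x)) \<partial>lborel)"
            using pK[OF G(2)[OF K \<open>K \<subseteq> \<Omega>\<close>] Gk t'] by (subst Bochner_Integration.integral_sum) auto
          also have "\<dots> = (\<integral>x. Gv x * ?\<phi> x \<partial>lborel)"
            by (simp add: Gv_sum sum_distrib_right mult.assoc)
          also have "\<dots> = g t"
            using integral_lborel_translate[of "\<lambda>x. Gv x * ?\<phi> x" "t *\<^sub>R v"] by (simp add: g_def)
          finally show ?thesis using d by simp
        qed
        have ftc: "(g has_integral F 1 - F 0) {0..1}"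
          by (rule fundamental_theorem_of_calculus)
            (use deriv in \<open>auto simp: has_real_derivative_iff_has_vector_derivative\<close>)
        have H\<psi>: "integrable (lborel \<Otimes>\<^sub>M lborel) (\<lambda>(t, p). H (t, p) * \<psi> p)"
        proof (rule Bochner_Integration.integrable_bound[OF H_int])
          have [measurable]: "H \<in> borel_measurable (lborel \<Otimes>\<^sub>M lborel)" using H_int by auto
          show "(\<lambda>(t, p). H (t, p) * \<psi> p) \<in> borel_measurable (lborel \<Otimes>\<^sub>M lborel)" by measurable
          show "AE z in lborel \<Otimes>\<^sub>M lborel. norm (case z of (t, p) \<Rightarrow> H (t, p) * \<psi> p) \<le> norm (H z)"
            using \<psi>1 by (intro AE_I2) (auto simp: abs_mult intro!: mult_right_le_one_le)
        qed
        have Hg: "(\<integral>p. H (t, p) * \<psi> p \<partial>lborel) = indicator {0..1} t *\<^sub>R g t" for t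
        proof -
          have "H (t, p) * \<psi> p = indicator {0..1} t * (Gv (p + t *\<^sub>R v) * \<psi> p)" for p
            using \<psi>0[of p] by (cases "\<psi> p = 0") (auto simp: H_def)
          then show ?thesis unfolding g_def by (simp only: integral_mult_right_zero real_scaleR_def)
        qed
        have g_int: "set_integrable lborel {0..1} g"
          unfolding set_integrable_def Hg[symmetric]
          using lborel_pair.integrable_fst[OF H\<psi>] by simp
        have "F 1 - F 0 = (LINT t:{0..1}|lborel. g t)"
          using set_borel_integral_eq_integral(2)[OF g_int] ftc by (simp add: integral_unique)
        also have "\<dots> = (\<integral>t. (\<integral>p. H (t, p) * \<psi> p \<partial>lborel) \<partial>lborel)"
          unfolding set_lebesgue_integral_def Hg ..
        also have "\<dots> = (\<integral>p. (\<integral>t. H (t, p) * \<psi> p \<partial>lborel) \<partial>lborel)"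
          by (rule lborel_pair.Fubini_integral[OF H\<psi>, symmetric])
        also have "\<dots> = (\<integral>p. J p * \<psi> p \<partial>lborel)"
        proof (rule Bochner_Integration.integral_cong[OF refl])
          fix p
          show "(\<integral>t. H (t, p) * \<psi> p \<partial>lborel) = J p * \<psi> p"
            using HJ[of p] \<psi>0[of p] by (cases "\<psi> p = 0") auto
        qed
        finally have FJ: "F 1 - F 0 = (\<integral>p. J p * \<psi> p \<partial>lborel)" .
        have i1: "integrable lborel (\<lambda>p. f (p + v) * \<psi> p)"
          using integrable_lborel_translate[OF pK[OF fK f(1), of 1], of v] by simp
        have i0: "integrable lborel (\<lambda>p. f p * \<psi> p)" using pK[OF fK f(1), of 0] by simp
        have iJ: "integrable lborel (\<lambda>p. J p * \<psi> p)"
          by (rule integrable_mult_bounded_support[OF J_int J_m, where B = 1]) (use \<psi>0 \<psi>1 in auto)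
        have "F 1 = (\<integral>p. f (p + v) * \<psi> p \<partial>lborel)"
          using integral_lborel_translate[of "\<lambda>x. f x * \<psi> (x - v)" v] by (simp add: F_def)
        then have "(\<integral>p. f (p + v) * \<psi> p \<partial>lborel) - (\<integral>p. f p * \<psi> p \<partial>lborel) - (\<integral>p. J p * \<psi> p \<partial>lborel) = 0"
          using FJ by (simp add: F_def)
        then have "(\<integral>p. f (p + v) * \<psi> p - f p * \<psi> p - J p * \<psi> p \<partial>lborel) = 0"
          using i1 i0 iJ by simp
        then show ?thesis by (simp add: w_def \<psi>_def left_diff_distrib)
      qed
      have w_m: "w \<in> borel_measurable borel" unfolding w_def by measurable
      have sub: "box c d \<subseteq> cbox a b" using cd box_subset_cbox by blast
      have "(\<lambda>m. \<integral>p. w p * box_bump m c d p \<partial>lborel) \<longlonglongrightarrow> (\<integral>p. w p * indicator (box c d) p \<partial>lborel)"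
      proof (rule integral_dominated_convergence[where w = "\<lambda>p. \<bar>indicator (cbox a b) p *\<^sub>R w p\<bar>"])
        show "(\<lambda>p. w p * indicator (box c d) p) \<in> borel_measurable lborel" using w_m by measurable
        show "(\<lambda>p. w p * box_bump m c d p) \<in> borel_measurable lborel" for m
          using w_m test_function_measurable(1)[OF box_bump_test_function[OF subset_UNIV], of m c d] by measurable
        show "integrable lborel (\<lambda>p. \<bar>indicator (cbox a b) p *\<^sub>R w p\<bar>)"
          using w_int unfolding set_integrable_def by (rule integrable_abs)
        show "AE p in lborel. (\<lambda>m. w p * box_bump m c d p) \<longlonglongrightarrow> w p * indicator (box c d) p"
          by (intro AE_I2 tendsto_mult tendsto_const box_bump_tendsto)
        show "AE p in lborel. norm (w p * box_bump m c d p) \<le> \<bar>indicator (cbox a b) p *\<^sub>R w p\<bar>" for m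
        proof (rule AE_I2)
          fix p
          show "norm (w p * box_bump m c d p) \<le> \<bar>indicator (cbox a b) p *\<^sub>R w p\<bar>"
          proof (cases "p \<in> box c d")
            case True
            then show ?thesis
              using subsetD[OF sub True] box_bump_bounds[of m c d p] by (auto simp: abs_mult intro!: mult_right_le_one_le)
          next
            case False
            then have "box_bump m c d p = 0" by (simp add: box_bump_eq_0_iff)
            then show ?thesis by simp
          qed
        qed
      qed
      then have "(\<integral>p. w p * indicator (box c d) p \<partial>lborel) = 0"
        unfolding zero by (simp add: LIMSEQ_const_iff)
      then show "(LINT p:box c d|lborel. w p) = 0"
        by (simp add: set_lebesgue_integral_def mult.commute)
    qed
  qed
  have "AE p in lborel. p \<in> ?U \<longrightarrow> w p = 0"
    by (rule AE_on_open_if_AE_on_boxes[OF open_cball_subset[OF \<Omega>] box])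
  then show ?thesis
    by eventually_elim (auto simp: w_def J_def Gv_def)
qed

text \<open>
  The exceptional set of points \<open>p\<close> depends on \<open>v\<close>. As both sides of the inequality are measurable
  in \<open>(p, v)\<close>, Tonelli's theorem turns ``for every \<open>v\<close>, for almost
  every \<open>p\<close>'' into ``for almost every \<open>p\<close>, for almost every \<open>v\<close>''. The radius \<open>2 \<bar>v\<bar>\<close> leaves room
  for the closed ball of radius \<open>\<bar>v\<bar>\<close> when \<open>v \<noteq> 0\<close>, and makes the condition on \<open>(p, v)\<close> closed.
\<close>

lemma AE_translation_difference_le:
  fixes f :: "real^'n \<Rightarrow> real" and G :: "real^'n \<Rightarrow> real^'n"
  assumes \<Omega>: "open \<Omega>"
    and f: "f \<in> borel_measurable borel" "\<And>K. compact K \<Longrightarrow> K \<subseteq> \<Omega> \<Longrightarrow> set_integrable lborel K f"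
    and G: "G \<in> borel_measurable borel" "\<And>K k. compact K \<Longrightarrow> K \<subseteq> \<Omega> \<Longrightarrow> set_integrable lborel K (\<lambda>x. G x $ k)"
    and weak: "\<And>\<phi> k. \<phi> \<in> test_functions \<Omega> \<Longrightarrow>
      (\<integral>x. f x * partial_derivative k \<phi> x \<partial>lborel) = - (\<integral>x. G x $ k * \<phi> x \<partial>lborel)"
  shows "AE p in lborel. AE v in lborel. ball p (2 * norm v) \<subseteq> \<Omega> \<longrightarrow>
    ennreal \<bar>f (p + v) - f p\<bar> \<le> (\<integral>\<^sup>+t\<in>{0..1}. ennreal (norm (G (p + t *\<^sub>R v)) * norm v) \<partial>lborel)"
    (is "AE p in lborel. AE v in lborel. ?P p v")
proof -
  note [measurable] = f(1) G(1)
  have "AE p in lborel. ?P p v" for v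
  proof -
    have "AE p in lborel. cball p (norm v) \<subseteq> \<Omega> \<longrightarrow>
        f (p + v) - f p = (\<integral>t. indicator {0..1} t * (G (p + t *\<^sub>R v) \<bullet> v) \<partial>lborel)"
      by (rule AE_translation_difference_eq[OF assms])
    then show ?thesis
    proof eventually_elim
      case (elim p)
      let ?q = "\<lambda>t. indicator {0..1} t * (G (p + t *\<^sub>R v) \<bullet> v)"
      show ?case
      proof
        assume sub: "ball p (2 * norm v) \<subseteq> \<Omega>"
        show "ennreal \<bar>f (p + v) - f p\<bar> \<le> (\<integral>\<^sup>+t\<in>{0..1}. ennreal (norm (G (p + t *\<^sub>R v)) * norm v) \<partial>lborel)"
        proof (cases "v = 0")
          case False
          then have "cball p (norm v) \<subseteq> ball p (2 * norm v)"
            by (simp add: cball_subset_ball_iff)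
          with elim sub have "f (p + v) - f p = (\<integral>t. ?q t \<partial>lborel)" by blast
          then have "ennreal \<bar>f (p + v) - f p\<bar> = ennreal (norm (\<integral>t. ?q t \<partial>lborel))" by simp
          also have "\<dots> \<le> (\<integral>\<^sup>+t. ennreal (norm (?q t)) \<partial>lborel)"
          proof (cases "integrable lborel ?q")
            case True
            then show ?thesis by (rule integral_norm_bound_ennreal)
          qed (simp add: not_integrable_integral_eq)
          also have "\<dots> \<le> (\<integral>\<^sup>+t\<in>{0..1}. ennreal (norm (G (p + t *\<^sub>R v)) * norm v) \<partial>lborel)"
            by (intro nn_integral_mono) (auto split: split_indicator simp: Cauchy_Schwarz_ineq2 intro!: ennreal_leI)
          finally show ?thesis .
        qed simp
      qed
    qed
  qed
  then have "AE v in lborel. AE p in lborel. ?P p v" by simp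
  moreover have "{x \<in> space (lborel \<Otimes>\<^sub>M lborel). ?P (fst x) (snd x)} \<in> sets (lborel \<Otimes>\<^sub>M lborel)"
  proof -
    have "- {x :: (real^'n) \<times> (real^'n). ball (fst x) (2 * norm (snd x)) \<subseteq> \<Omega>} =
        (\<Union>y\<in>-\<Omega>. {x. dist (fst x) y < 2 * norm (snd x)})"
      by (auto simp: subset_eq)
    moreover have "open {x :: (real^'n) \<times> (real^'n). dist (fst x) y < 2 * norm (snd x)}" for y
      by (intro open_Collect_less continuous_intros)
    ultimately have "closed {x :: (real^'n) \<times> (real^'n). ball (fst x) (2 * norm (snd x)) \<subseteq> \<Omega>}"
      by (auto simp: closed_def)
    then have [measurable]: "Measurable.pred (lborel \<Otimes>\<^sub>M lborel) (\<lambda>x :: (real^'n) \<times> (real^'n). ball (fst x) (2 * norm (snd x)) \<subseteq> \<Omega>)"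
      unfolding pred_def lborel_prod by (simp add: borel_closed)
    show ?thesis by measurable
  qed
  ultimately show ?thesis
    by (subst lborel_pair.AE_commute) auto
qed

section \<open>Averages over balls\<close>

lemma emeasure_ball_scale:
  fixes x y :: "'a::euclidean_space"
  assumes "0 \<le> c" "0 \<le> r"
  shows "emeasure lborel (ball x (c * r)) = ennreal (c ^ DIM('a)) * emeasure lborel (ball y r)"
  using assms by (simp add: emeasure_ball power_mult_distrib ennreal_mult[symmetric] unit_ball_vol_nonneg mult_ac)

lemma nn_integral_ball_dilate_le:
  fixes h :: "'a::euclidean_space \<Rightarrow> ennreal"
  assumes h: "h \<in> borel_measurable borel" and t: "0 < t" and d: "0 < d"
    and M: "(\<integral>\<^sup>+z\<in>ball p (t * d). h z \<partial>lborel) \<le> M * emeasure lborel (ball p (t * d))"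
  shows "(\<integral>\<^sup>+v\<in>ball 0 d. h (p + t *\<^sub>R v) \<partial>lborel) \<le> M * emeasure lborel (ball p d)"
proof -
  note [measurable] = h
  have [measurable]: "ball q r \<in> sets borel" for q :: 'a and r by simp
  have ind: "indicator (ball p (t * d)) (p + t *\<^sub>R v) = (indicator (ball 0 d) v :: ennreal)" for v
    using t by (auto simp: dist_norm split: split_indicator)
  have "(\<integral>\<^sup>+z\<in>ball p (t * d). h z \<partial>lborel) =
      (\<integral>\<^sup>+z. h z * indicator (ball p (t * d)) z \<partial>density (distr lborel borel (\<lambda>x. p + t *\<^sub>R x)) (\<lambda>_. \<bar>t\<bar> ^ DIM('a)))"
    using lborel_affine[of t p] t by simp
  also have "\<dots> = ennreal (t ^ DIM('a)) * (\<integral>\<^sup>+v\<in>ball 0 d. h (p + t *\<^sub>R v) \<partial>lborel)"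
    using t by (subst nn_integral_density, measurable, subst nn_integral_distr, measurable)
      (simp add: ind nn_integral_cmult)
  finally have "ennreal (t ^ DIM('a)) * (\<integral>\<^sup>+v\<in>ball 0 d. h (p + t *\<^sub>R v) \<partial>lborel)
      \<le> ennreal (t ^ DIM('a)) * (M * emeasure lborel (ball p d))"
    using M emeasure_ball_scale[of t d p p] t d by (simp add: mult_ac)
  then show ?thesis
    using t by (subst (asm) ennreal_mult_le_mult_iff) auto
qed

text \<open>
  Integrating the translation inequality over \<open>\<bar>v\<bar> < d\<close> and exchanging the integrals, the inner
  integral over \<open>v\<close> at time \<open>t\<close> is a dilated integral of \<open>\<bar>G\<bar>\<close> over the ball of radius \<open>t d\<close> around
  the \<^emph>\<open>same\<close> centre \<open>p\<close>, so the bound \<open>M\<close> on averages over balls around \<open>p\<close> applies for every \<open>t\<close>.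
  This yields a Poincare inequality centred at the point \<open>p\<close>, where the value \<open>f p\<close> itself, rather
  than a mean of \<open>f\<close>, is compared with \<open>f\<close> on the ball.
\<close>

lemma nn_integral_ball_difference_le:
  fixes f :: "'a::euclidean_space \<Rightarrow> real" and G :: "'a \<Rightarrow> 'b::euclidean_space"
  assumes f: "f \<in> borel_measurable borel" and G: "G \<in> borel_measurable borel"
    and diff: "AE v in lborel. ball p (2 * norm v) \<subseteq> \<Omega> \<longrightarrow>
      ennreal \<bar>f (p + v) - f p\<bar> \<le> (\<integral>\<^sup>+t\<in>{0..1}. ennreal (norm (G (p + t *\<^sub>R v)) * norm v) \<partial>lborel)"
    and d: "d > 0" "ball p (2 * d) \<subseteq> \<Omega>"
    and M: "\<And>r. r > 0 \<Longrightarrow> (\<integral>\<^sup>+z\<in>ball p r. ennreal (norm (G z)) \<partial>lborel) \<le> M * emeasure lborel (ball p r)"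
  shows "(\<integral>\<^sup>+z\<in>ball p d. ennreal \<bar>f z - f p\<bar> \<partial>lborel) \<le> ennreal d * (M * emeasure lborel (ball p d))"
proof -
  note [measurable] = f G
  have [measurable]: "ball q r \<in> sets borel" for q :: 'a and r by simp
  let ?h = "\<lambda>z. ennreal (norm (G z))"
  have "(\<integral>\<^sup>+z\<in>ball p d. ennreal \<bar>f z - f p\<bar> \<partial>lborel)
      = (\<integral>\<^sup>+v. ennreal \<bar>f (v + p) - f p\<bar> * indicator (ball p d) (v + p) \<partial>lborel)"
    by (rule nn_integral_lborel_translate[symmetric]) measurable
  also have "\<dots> = (\<integral>\<^sup>+v\<in>ball 0 d. ennreal \<bar>f (p + v) - f p\<bar> \<partial>lborel)"
    by (intro nn_integral_cong) (auto simp: dist_norm add.commute split: split_indicator)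
  also have "\<dots> \<le> (\<integral>\<^sup>+v. (\<integral>\<^sup>+t. (ennreal d * indicator {0..1} t) * (?h (p + t *\<^sub>R v) * indicator (ball 0 d) v) \<partial>lborel) \<partial>lborel)"
  proof (rule nn_integral_mono_AE, use diff in eventually_elim)
    fix v
    assume v: "ball p (2 * norm v) \<subseteq> \<Omega> \<longrightarrow>
      ennreal \<bar>f (p + v) - f p\<bar> \<le> (\<integral>\<^sup>+t\<in>{0..1}. ennreal (norm (G (p + t *\<^sub>R v)) * norm v) \<partial>lborel)"
    show "ennreal \<bar>f (p + v) - f p\<bar> * indicator (ball 0 d) v
      \<le> (\<integral>\<^sup>+t. (ennreal d * indicator {0..1} t) * (?h (p + t *\<^sub>R v) * indicator (ball 0 d) v) \<partial>lborel)"
    proof (cases "v \<in> ball 0 d")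
      case True
      then have vd: "norm v < d" by simp
      then have "ball p (2 * norm v) \<subseteq> \<Omega>" using d(2) subset_ball[of "2 * norm v" "2 * d" p] by auto
      then have "ennreal \<bar>f (p + v) - f p\<bar> \<le> (\<integral>\<^sup>+t\<in>{0..1}. ennreal (norm (G (p + t *\<^sub>R v)) * norm v) \<partial>lborel)"
        using v by blast
      also have "\<dots> \<le> (\<integral>\<^sup>+t. (ennreal d * indicator {0..1} t) * ?h (p + t *\<^sub>R v) \<partial>lborel)"
      proof (rule nn_integral_mono)
        fix t :: real
        have "ennreal (norm (G (p + t *\<^sub>R v)) * norm v) \<le> ennreal (norm (G (p + t *\<^sub>R v)) * d)"
          using vd by (intro ennreal_leI mult_left_mono) auto
        also have "\<dots> = ennreal d * ?h (p + t *\<^sub>R v)"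
          using d by (simp add: ennreal_mult mult.commute)
        finally show "ennreal (norm (G (p + t *\<^sub>R v)) * norm v) * indicator {0..1} t
            \<le> (ennreal d * indicator {0..1} t) * ?h (p + t *\<^sub>R v)"
          by (auto split: split_indicator)
      qed
      finally show ?thesis using True by simp
    qed simp
  qed
  also have "\<dots> = (\<integral>\<^sup>+t. (\<integral>\<^sup>+v. (ennreal d * indicator {0..1} t) * (?h (p + t *\<^sub>R v) * indicator (ball 0 d) v) \<partial>lborel) \<partial>lborel)"
    by (rule lborel_pair.Fubini') measurable
  also have "\<dots> = (\<integral>\<^sup>+t. (ennreal d * indicator {0..1} t) * (\<integral>\<^sup>+v\<in>ball 0 d. ?h (p + t *\<^sub>R v) \<partial>lborel) \<partial>lborel)"
    by (intro nn_integral_cong nn_integral_cmult) measurable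
  also have "\<dots> \<le> (\<integral>\<^sup>+t. (ennreal d * (M * emeasure lborel (ball p d))) * indicator {0..1::real} t \<partial>lborel)"
  proof (rule nn_integral_mono_AE, use AE_lborel_singleton[of "0::real"] in eventually_elim)
    fix t :: real assume "t \<noteq> 0"
    show "(ennreal d * indicator {0..1} t) * (\<integral>\<^sup>+v\<in>ball 0 d. ?h (p + t *\<^sub>R v) \<partial>lborel)
      \<le> (ennreal d * (M * emeasure lborel (ball p d))) * indicator {0..1} t"
    proof (cases "t \<in> {0..1}")
      case True
      with \<open>t \<noteq> 0\<close> have t: "0 < t" by auto
      have "(\<integral>\<^sup>+v\<in>ball 0 d. ?h (p + t *\<^sub>R v) \<partial>lborel) \<le> M * emeasure lborel (ball p d)"
        by (rule nn_integral_ball_dilate_le[OF _ t d(1) M]) (use t d in auto)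
      then show ?thesis using True by (auto intro: mult_left_mono)
    qed simp
  qed
  also have "\<dots> = ennreal d * (M * emeasure lborel (ball p d))"
    by (simp add: nn_integral_cmult_indicator)
  finally show ?thesis .
qed

text \<open>
  The ball of radius \<open>d / 2\<close> around the midpoint lies in both balls. Averaging the triangle
  inequality \<open>\<bar>f x - f y\<bar> \<le> \<bar>f z - f x\<bar> + \<bar>f z - f y\<bar>\<close> over its points \<open>z\<close> costs the ratio of the
  volumes, which is two to the power of the dimension.
\<close>

lemma difference_le_if_ball_averages:
  fixes f :: "'a::euclidean_space \<Rightarrow> real"
  assumes f: "f \<in> borel_measurable borel" and d: "d = dist x y" "d > 0"
    and x: "(\<integral>\<^sup>+z\<in>ball x d. ennreal \<bar>f z - f x\<bar> \<partial>lborel) \<le> ennreal d * (ennreal a * emeasure lborel (ball x d))"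
    and y: "(\<integral>\<^sup>+z\<in>ball y d. ennreal \<bar>f z - f y\<bar> \<partial>lborel) \<le> ennreal d * (ennreal b * emeasure lborel (ball y d))"
    and ab: "0 \<le> a" "0 \<le> b"
  shows "\<bar>f x - f y\<bar> \<le> d * (2 ^ DIM('a) * a + 2 ^ DIM('a) * b)"
proof -
  note [measurable] = f
  have [measurable]: "ball q r \<in> sets borel" for q :: 'a and r by simp
  define A where "A = ball (midpoint x y) (d / 2)"
  have A: "A \<subseteq> ball x d" "A \<subseteq> ball y d"
    unfolding A_def using d
    by (auto intro!: subset_ball simp: ball_subset_ball_iff dist_midpoint)
  have vol: "emeasure lborel (ball z d) = ennreal (2 ^ DIM('a)) * emeasure lborel A" for z :: 'a
    using emeasure_ball_scale[of 2 "d / 2" z "midpoint x y"] d by (simp add: A_def)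
  have fin: "0 < emeasure lborel A" "emeasure lborel A < \<infinity>"
    using d unfolding A_def by (auto simp: emeasure_ball ennreal_zero_less_mult_iff)
  have "ennreal \<bar>f x - f y\<bar> * emeasure lborel A = (\<integral>\<^sup>+z\<in>A. ennreal \<bar>f x - f y\<bar> \<partial>lborel)"
    by (simp add: nn_integral_cmult_indicator A_def)
  also have "\<dots> \<le> (\<integral>\<^sup>+z. ennreal \<bar>f z - f x\<bar> * indicator (ball x d) z + ennreal \<bar>f z - f y\<bar> * indicator (ball y d) z \<partial>lborel)"
  proof (rule nn_integral_mono)
    fix z
    have "\<bar>f x - f y\<bar> \<le> \<bar>f z - f x\<bar> + \<bar>f z - f y\<bar>" by linarith
    then have "ennreal \<bar>f x - f y\<bar> \<le> ennreal \<bar>f z - f x\<bar> + ennreal \<bar>f z - f y\<bar>"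
      by (simp flip: ennreal_plus)
    then show "ennreal \<bar>f x - f y\<bar> * indicator A z
        \<le> ennreal \<bar>f z - f x\<bar> * indicator (ball x d) z + ennreal \<bar>f z - f y\<bar> * indicator (ball y d) z"
      using subsetD[OF A(1), of z] subsetD[OF A(2), of z] by (cases "z \<in> A") auto
  qed
  also have "\<dots> = (\<integral>\<^sup>+z\<in>ball x d. ennreal \<bar>f z - f x\<bar> \<partial>lborel) + (\<integral>\<^sup>+z\<in>ball y d. ennreal \<bar>f z - f y\<bar> \<partial>lborel)"
    by (rule nn_integral_add) measurable
  also have "\<dots> \<le> ennreal d * (ennreal a * emeasure lborel (ball x d)) + ennreal d * (ennreal b * emeasure lborel (ball y d))"
    by (rule add_mono[OF x y])
  also have "\<dots> = (ennreal d * ennreal a * ennreal (2 ^ DIM('a)) + ennreal d * ennreal b * ennreal (2 ^ DIM('a))) * emeasure lborel A"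
    unfolding vol by (simp add: distrib_right mult.assoc)
  also have "ennreal d * ennreal a * ennreal (2 ^ DIM('a)) + ennreal d * ennreal b * ennreal (2 ^ DIM('a))
      = ennreal (d * (2 ^ DIM('a) * a + 2 ^ DIM('a) * b))"
    using d ab by (simp add: distrib_left mult_ac flip: ennreal_mult ennreal_plus)
  finally have "ennreal \<bar>f x - f y\<bar> \<le> ennreal (d * (2 ^ DIM('a) * a + 2 ^ DIM('a) * b))"
    using fin by (simp add: ennreal_mult_le_mult_iff mult.commute[of _ "emeasure lborel A"])
  then show ?thesis
    using d ab by (subst (asm) ennreal_le_iff) auto
qed

section \<open>The characterization\<close>

lemma maximal_function_cong_AE:
  assumes "AE x in lborel. g x = h x"
  shows "maximal_function g = maximal_function h"
proof -
  have "AE x in lebesgue. g x = h x" using assms by (rule AE_completion)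
  then have "(\<integral>\<^sup>+y\<in>ball x r. ennreal \<bar>g y\<bar> \<partial>lebesgue) = (\<integral>\<^sup>+y\<in>ball x r. ennreal \<bar>h y\<bar> \<partial>lebesgue)" for x r
    by (intro nn_integral_cong_AE) (auto elim: eventually_mono)
  then show ?thesis unfolding maximal_function_def by simp
qed

lemma nn_integral_ball_le_maximal_function:
  assumes "r > 0"
  shows "(\<integral>\<^sup>+y\<in>ball x r. ennreal \<bar>h y\<bar> \<partial>lborel) \<le> maximal_function h x * emeasure lborel (ball x r)"
proof -
  let ?I = "\<integral>\<^sup>+y\<in>ball x r. ennreal \<bar>h y\<bar> \<partial>lebesgue"
  have vol: "emeasure lebesgue (ball x r) = emeasure lborel (ball x r)" by simp
  have fin: "emeasure lborel (ball x r) \<noteq> 0" "emeasure lborel (ball x r) \<noteq> \<infinity>"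
    using assms by (auto simp: emeasure_ball ennreal_eq_0_iff not_le unit_ball_vol_pos)
  have "?I / emeasure lebesgue (ball x r) \<le> maximal_function h x"
    unfolding maximal_function_def using assms by (intro SUP_upper) auto
  then have "?I / emeasure lborel (ball x r) * emeasure lborel (ball x r)
      \<le> maximal_function h x * emeasure lborel (ball x r)"
    unfolding vol by (rule mult_right_mono) simp
  then have "?I \<le> maximal_function h x * emeasure lborel (ball x r)"
    using fin by (simp add: ennreal_divide_times ennreal_divide_self less_top)
  then show ?thesis by (simp add: nn_integral_completion)
qed

text \<open>
  Since the balls of radius \<open>2 d\<close> around \<open>x\<close> and \<open>y\<close> both lie in the ball of radius \<open>3 d\<close> around \<open>x\<close>,
  where \<open>d\<close> is the distance of \<open>x\<close> and \<open>y\<close>, the Poincare inequality of the previous section is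
  available at both points.
\<close>

lemma Hajlasz_gradient_of_weak_gradient:
  fixes f :: "real^'n \<Rightarrow> real" and G :: "real^'n \<Rightarrow> real^'n"
  assumes \<Omega>: "open \<Omega>" and weak: "weak_gradient \<Omega> f G"
  defines "M \<equiv> maximal_function (zero_extend \<Omega> (\<lambda>x. norm (G x)))"
  assumes fin: "AE x in lebesgue_on \<Omega>. M x < \<infinity>"
  shows "\<exists>S\<subseteq>\<Omega>. S \<in> null_sets lebesgue \<and>
    (\<forall>x\<in>\<Omega> - S. \<forall>y\<in>\<Omega> - S. ball x (3 * dist x y) \<subseteq> \<Omega> \<longrightarrow>
      \<bar>f x - f y\<bar> \<le> dist x y * (2 ^ CARD('n) * enn2real (M x) + 2 ^ CARD('n) * enn2real (M y)))"
proof -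
  have fL: "f \<in> L1_loc \<Omega>" and GL: "(\<lambda>x. G x $ k) \<in> L1_loc \<Omega>" for k
    using weak by (auto simp: weak_gradient_def)
  have fm: "f \<in> borel_measurable (lebesgue_on \<Omega>)" and Gm: "(\<lambda>x. G x $ k) \<in> borel_measurable (lebesgue_on \<Omega>)" for k
    using fL GL by (auto simp: L1_loc_def)
  obtain f' where f': "f' \<in> borel_measurable borel" "AE x in lborel. f' x = zero_extend \<Omega> f x"
    using borel_representative[OF \<Omega> fm] by blast
  have "\<exists>G'. G' \<in> borel_measurable borel \<and> (AE x in lborel. G' x = zero_extend \<Omega> (\<lambda>x. G x $ k) x)" for k
    using borel_representative[OF \<Omega> Gm] by blast
  then obtain Gc where Gc: "\<And>k. Gc k \<in> borel_measurable borel"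
    "\<And>k. AE x in lborel. Gc k x = zero_extend \<Omega> (\<lambda>x. G x $ k) x" by metis
  define G' where "G' x = (\<chi> k. Gc k x)" for x
  have G'm: "G' \<in> borel_measurable borel"
  proof (rule borel_measurable_euclidean_space[THEN iffD2], rule ballI)
    fix b :: "real^'n" assume "b \<in> Basis"
    then obtain k where "b = axis k 1" by (auto simp: Basis_vec_def)
    then show "(\<lambda>x. G' x \<bullet> b) \<in> borel_measurable borel"
      using Gc(1)[of k] by (simp add: G'_def flip: cart_eq_inner_axis)
  qed
  have diff: "AE p in lborel. AE v in lborel. ball p (2 * norm v) \<subseteq> \<Omega> \<longrightarrow>
    ennreal \<bar>f' (p + v) - f' p\<bar> \<le> (\<integral>\<^sup>+t\<in>{0..1}. ennreal (norm (G' (p + t *\<^sub>R v)) * norm v) \<partial>lborel)"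
  proof (rule AE_translation_difference_le[OF \<Omega> f'(1) _ G'm])
    show "set_integrable lborel K f'" if "compact K" "K \<subseteq> \<Omega>" for K
      by (rule borel_representative_set_integrable[OF fL \<Omega> f' that])
    show "set_integrable lborel K (\<lambda>x. G' x $ k)" if "compact K" "K \<subseteq> \<Omega>" for K k
      using borel_representative_set_integrable[OF GL \<Omega> Gc that] by (simp add: G'_def)
    fix \<phi> k assume \<phi>: "\<phi> \<in> test_functions \<Omega>"
    have "(LINT x:\<Omega>|lebesgue. f x * partial_derivative k \<phi> x) = - (LINT x:\<Omega>|lebesgue. G x $ k * \<phi> x)"
      using weak \<phi> by (simp add: weak_gradient_def)
    then show "(\<integral>x. f' x * partial_derivative k \<phi> x \<partial>lborel) = - (\<integral>x. G' x $ k * \<phi> x \<partial>lborel)"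
      using borel_representative_integral[OF fm \<Omega> f' test_function_measurable(2)[OF \<phi>], of k]
        borel_representative_integral[OF Gm \<Omega> Gc test_function_measurable(1)[OF \<phi>], of k]
      by (simp add: G'_def)
  qed
  have "AE x in lborel. \<forall>k\<in>UNIV. Gc k x = zero_extend \<Omega> (\<lambda>x. G x $ k) x"
    by (rule AE_finite_allI) (use Gc(2) in auto)
  then have "AE x in lborel. zero_extend \<Omega> (\<lambda>x. norm (G x)) x = norm (G' x)"
  proof eventually_elim
    case (elim x)
    show ?case
    proof (cases "x \<in> \<Omega>")
      case True
      then have "G' x = G x" using elim by (simp add: vec_eq_iff G'_def zero_extend_def)
      then show ?thesis using True by (simp add: zero_extend_def)
    next
      case False
      then have "G' x = 0" using elim by (simp add: vec_eq_iff G'_def zero_extend_def)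
      then show ?thesis using False by (simp add: zero_extend_def)
    qed
  qed
  then have M: "M = maximal_function (\<lambda>x. norm (G' x))"
    unfolding M_def by (rule maximal_function_cong_AE)
  \<comment> \<open>the complement of the exceptional set: points where the representative agrees with \<open>f\<close>, the
    maximal function is finite, and the translation inequality holds for almost every \<open>v\<close>\<close>
  define good where "good x \<longleftrightarrow> f' x = f x \<and> M x < \<infinity> \<and>
    (AE v in lborel. ball x (2 * norm v) \<subseteq> \<Omega> \<longrightarrow>
      ennreal \<bar>f' (x + v) - f' x\<bar> \<le> (\<integral>\<^sup>+t\<in>{0..1}. ennreal (norm (G' (x + t *\<^sub>R v)) * norm v) \<partial>lborel))" for x
  have "AE x in lborel. x \<in> \<Omega> \<longrightarrow> good x"
    using f'(2) diff fin[unfolded AE_lebesgue_on_iff[OF \<Omega>]]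
    by eventually_elim (auto simp: good_def zero_extend_def)
  then obtain Z where "{x \<in> space lborel. \<not> (x \<in> \<Omega> \<longrightarrow> good x)} \<subseteq> Z" "emeasure lborel Z = 0" "Z \<in> sets lborel"
    by (rule AE_E)
  then have null: "{x \<in> \<Omega>. \<not> good x} \<in> null_sets lebesgue"
    unfolding null_sets_completion_iff2 by (intro bexI[of _ Z]) auto
  have ball: "(\<integral>\<^sup>+z\<in>ball x d. ennreal \<bar>f' z - f' x\<bar> \<partial>lborel)
      \<le> ennreal d * (ennreal (enn2real (M x)) * emeasure lborel (ball x d))"
    if "good x" "d > 0" "ball x (2 * d) \<subseteq> \<Omega>" for x d
  proof (rule nn_integral_ball_difference_le[OF f'(1) G'm _ that(2,3)])
    show "AE v in lborel. ball x (2 * norm v) \<subseteq> \<Omega> \<longrightarrow>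
      ennreal \<bar>f' (x + v) - f' x\<bar> \<le> (\<integral>\<^sup>+t\<in>{0..1}. ennreal (norm (G' (x + t *\<^sub>R v)) * norm v) \<partial>lborel)"
      using that(1) unfolding good_def by (elim conjE)
    have "ennreal (enn2real (M x)) = M x" using that(1) by (simp add: good_def)
    then show "(\<integral>\<^sup>+z\<in>ball x r. ennreal (norm (G' z)) \<partial>lborel) \<le> ennreal (enn2real (M x)) * emeasure lborel (ball x r)"
      if "r > 0" for r
      using nn_integral_ball_le_maximal_function[OF that, where h = "\<lambda>x. norm (G' x)"] by (simp add: M)
  qed
  show ?thesis
  proof (intro exI[of _ "{x \<in> \<Omega>. \<not> good x}"] conjI null ballI impI)
    fix x y assume xy: "x \<in> \<Omega> - {x \<in> \<Omega>. \<not> good x}" "y \<in> \<Omega> - {x \<in> \<Omega>. \<not> good x}"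
      and sub: "ball x (3 * dist x y) \<subseteq> \<Omega>"
    show "\<bar>f x - f y\<bar> \<le> dist x y * (2 ^ CARD('n) * enn2real (M x) + 2 ^ CARD('n) * enn2real (M y))"
    proof (cases "x = y")
      case False
      define d where "d = dist x y"
      have d: "d > 0" using False by (simp add: d_def)
      have g: "good x" "good y" using xy by auto
      have "ball x (2 * d) \<subseteq> \<Omega>" using sub d subset_ball[of "2 * d" "3 * d" x] by (auto simp: d_def)
      moreover have "ball y (2 * d) \<subseteq> ball x (3 * d)"
        using dist_commute[of x y] by (simp add: ball_subset_ball_iff d_def)
      then have "ball y (2 * d) \<subseteq> \<Omega>" using sub by (simp add: d_def)
      ultimately have "\<bar>f' x - f' y\<bar> \<le> d * (2 ^ DIM(real^'n) * enn2real (M x) + 2 ^ DIM(real^'n) * enn2real (M y))"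
        using g d by (intro difference_le_if_ball_averages[OF f'(1) d_def d ball ball]) auto
      then show ?thesis using g by (simp add: good_def d_def)
    qed simp
  qed auto
qed

text \<open>
  The weak partial derivatives are constructed one at a time, each bounded by \<open>2 g\<close>; summing the bounds
  over the coordinates gives the factor \<open>CARD('n)\<close>.
\<close>

lemma weak_gradient_of_Hajlasz_gradient:
  fixes f g :: "real^'n \<Rightarrow> real"
  assumes \<Omega>: "open \<Omega>" and f: "f \<in> L1_loc \<Omega>" and g: "g \<in> L1_loc \<Omega>" "\<And>x. x \<in> \<Omega> \<Longrightarrow> 0 \<le> g x"
    and S: "S \<in> null_sets lebesgue"
    and ineq: "\<And>x y. x \<in> \<Omega> - S \<Longrightarrow> y \<in> \<Omega> - S \<Longrightarrow> ball x (3 * dist x y) \<subseteq> \<Omega> \<Longrightarrow>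
      \<bar>f x - f y\<bar> \<le> dist x y * (g x + g y)"
  obtains G where "weak_gradient \<Omega> f G" "G \<in> borel_measurable borel"
    "AE x in lebesgue_on \<Omega>. norm (G x) \<le> 2 * real CARD('n) * g x"
proof -
  have fm: "f \<in> borel_measurable (lebesgue_on \<Omega>)" and gm: "g \<in> borel_measurable (lebesgue_on \<Omega>)"
    using f g by (auto simp: L1_loc_def)
  obtain f' where f': "f' \<in> borel_measurable borel" "AE x in lborel. f' x = zero_extend \<Omega> f x"
    using borel_representative[OF \<Omega> fm] by blast
  obtain g0 where g0: "g0 \<in> borel_measurable borel" "AE x in lborel. g0 x = zero_extend \<Omega> g x"
    using borel_representative[OF \<Omega> gm] by blast
  \<comment> \<open>the absolute value makes the Borel representative nonnegative everywhere\<close>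
  define g' where "g' x = \<bar>g0 x\<bar>" for x
  have g': "g' \<in> borel_measurable borel" "AE x in lborel. g' x = zero_extend \<Omega> g x"
  proof -
    show "g' \<in> borel_measurable borel" unfolding g'_def using g0(1) by measurable
    show "AE x in lborel. g' x = zero_extend \<Omega> g x"
      using g0(2) by eventually_elim (auto simp: g'_def zero_extend_def g(2))
  qed
  have f'i: "set_integrable lborel K f'" and g'i: "set_integrable lborel K g'"
    if "compact K" "K \<subseteq> \<Omega>" for K
    using borel_representative_set_integrable[OF f \<Omega> f' that] borel_representative_set_integrable[OF g(1) \<Omega> g' that] .
  let ?good = "{x. x \<notin> S \<and> f' x = zero_extend \<Omega> f x \<and> g' x = zero_extend \<Omega> g x}"
  have "AE x in lborel. x \<notin> S"
    using AE_not_in[OF S] by (simp add: AE_completion_iff)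
  then have good: "AE x in lborel. x \<in> ?good"
    using f'(2) g'(2) by eventually_elim auto
  have g'0: "0 \<le> g' x" for x by (simp add: g'_def)
  have ineq': "\<bar>f' x - f' y\<bar> \<le> dist x y * (g' x + g' y)"
    if "x \<in> ?good" "y \<in> ?good" "ball x (3 * dist x y) \<subseteq> \<Omega>" "x \<in> \<Omega>" "y \<in> \<Omega>" for x y
    using ineq[of x y] that by (simp add: zero_extend_def)
  have ex: "\<exists>v. v \<in> borel_measurable borel \<and> (\<forall>x. \<bar>v x\<bar> \<le> 2 * g' x) \<and> (\<forall>\<phi>\<in>test_functions \<Omega>.
      (\<integral>x. f' x * partial_derivative k \<phi> x \<partial>lborel) = - (\<integral>x. v x * \<phi> x \<partial>lborel))" for k
  proof -
    obtain v where "v \<in> borel_measurable borel" "\<And>x. \<bar>v x\<bar> \<le> 2 * g' x"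
      "\<And>\<phi>. \<phi> \<in> test_functions \<Omega> \<Longrightarrow>
        (\<integral>x. f' x * partial_derivative k \<phi> x \<partial>lborel) = - (\<integral>x. v x * \<phi> x \<partial>lborel)"
      by (rule weak_partial_derivative_exists[OF \<Omega> f'(1) f'i g'(1) g'i g'0 good ineq', of k]; (assumption | rule that))
    then show ?thesis by (intro exI[of _ v]) simp
  qed
  obtain V where V': "\<forall>k. V k \<in> borel_measurable borel \<and> (\<forall>x. \<bar>V k x\<bar> \<le> 2 * g' x) \<and> (\<forall>\<phi>\<in>test_functions \<Omega>.
      (\<integral>x. f' x * partial_derivative k \<phi> x \<partial>lborel) = - (\<integral>x. V k x * \<phi> x \<partial>lborel))"
    using choice[OF allI[OF ex]] by (rule exE)
  have V: "V k \<in> borel_measurable borel" "\<bar>V k x\<bar> \<le> 2 * g' x"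
    "\<phi> \<in> test_functions \<Omega> \<Longrightarrow>
      (\<integral>x. f' x * partial_derivative k \<phi> x \<partial>lborel) = - (\<integral>x. V k x * \<phi> x \<partial>lborel)" for k x \<phi>
    using V' by simp_all
  define G where "G x = (\<chi> k. V k x)" for x
  have Gk: "G x $ k = V k x" for x k by (simp add: G_def)
  show ?thesis
  proof (rule that)
    have VL: "V k \<in> L1_loc \<Omega>" for k
    proof (rule L1_locI[OF V(1)])
      fix K assume K: "compact K" "K \<subseteq> \<Omega>"
      then have [measurable]: "K \<in> sets borel" by (simp add: borel_compact)
      note [measurable] = V(1)
      have "integrable lborel (\<lambda>x. 2 * (indicator K x *\<^sub>R g' x))"
        using g'i[OF K] unfolding set_integrable_def by simp
      then show "set_integrable lborel K (V k)"
        unfolding set_integrable_def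
        by (rule Bochner_Integration.integrable_bound)
          (use V(2)[of k] in \<open>auto split: split_indicator simp: g'_def\<close>)
    qed
    show "weak_gradient \<Omega> f G"
      unfolding weak_gradient_def Gk
    proof (intro conjI ballI allI f)
      show "(\<lambda>x. V k x) \<in> L1_loc \<Omega>" for k using VL by simp
      fix \<phi> k assume \<phi>: "\<phi> \<in> test_functions \<Omega>"
      have "(LINT x:\<Omega>|lebesgue. V k x * \<phi> x) = (\<integral>x. V k x * \<phi> x \<partial>lborel)"
      proof -
        have z: "zero_extend \<Omega> (V k) x * \<phi> x = V k x * \<phi> x" for x
          using test_function_compact_support(2)[OF \<phi>] closure_subset[of "{x. \<phi> x \<noteq> 0}"]
          by (auto simp: zero_extend_def)
        have "(LINT x:\<Omega>|lebesgue. V k x * \<phi> x) = (\<integral>x. zero_extend \<Omega> (V k) x * \<phi> x \<partial>lebesgue)"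
          unfolding set_lebesgue_integral_def zero_extend_def
          by (intro Bochner_Integration.integral_cong) (auto simp: indicator_def)
        also have "\<dots> = (\<integral>x. V k x * \<phi> x \<partial>lebesgue)" by (simp only: z)
        also have "\<dots> = (\<integral>x. V k x * \<phi> x \<partial>lborel)"
          by (rule integral_completion) (use V(1) test_function_measurable(1)[OF \<phi>] in measurable)
        finally show ?thesis .
      qed
      then show "(LINT x:\<Omega>|lebesgue. f x * partial_derivative k \<phi> x) = - (LINT x:\<Omega>|lebesgue. V k x * \<phi> x)"
        using borel_representative_integral[OF fm \<Omega> f' test_function_measurable(2)[OF \<phi>], of k] V(3)[OF \<phi>, of k]
        by simp
    qed
    show "G \<in> borel_measurable borel"
    proof (rule borel_measurable_euclidean_space[THEN iffD2], rule ballI)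
      fix b :: "real^'n" assume "b \<in> Basis"
      then obtain k where "b = axis k 1" by (auto simp: Basis_vec_def)
      then show "(\<lambda>x. G x \<bullet> b) \<in> borel_measurable borel"
        using V(1)[of k] by (simp add: G_def flip: cart_eq_inner_axis)
    qed
    have "norm (G x) \<le> 2 * real CARD('n) * g' x" for x
    proof -
      have "norm (G x) \<le> (\<Sum>k\<in>UNIV. \<bar>G x $ k\<bar>)" by (rule norm_le_l1_cart)
      also have "\<dots> \<le> (\<Sum>k\<in>(UNIV::'n set). 2 * g' x)" by (intro sum_mono) (simp add: Gk V(2))
      finally show ?thesis by simp
    qed
    note bound = this
    have "AE x in lborel. x \<in> \<Omega> \<longrightarrow> norm (G x) \<le> 2 * real CARD('n) * g x"
      using g'(2)
    proof eventually_elim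
      case (elim x)
      then show ?case using bound[of x] by (cases "x \<in> \<Omega>") (simp_all add: zero_extend_def)
    qed
    then show "AE x in lebesgue_on \<Omega>. norm (G x) \<le> 2 * real CARD('n) * g x"
      by (simp add: AE_lebesgue_on_iff[OF \<Omega>])
  qed
qed

theorem theorem2p2:
  fixes \<Omega> :: "(real^'n) set"
    and X :: "(real^'n \<Rightarrow> real) set"
    and N :: "(real^'n \<Rightarrow> real) \<Rightarrow> real"
    and f :: "real^'n \<Rightarrow> real"
  assumes "open \<Omega>" and "connected \<Omega>"
    and "banach_function_space \<Omega> X N"
    and "lattice_property \<Omega> X N"
    and "maximal_operator_bounded \<Omega> X N"
  shows "f \<in> W1 \<Omega> X \<longleftrightarrow>
    f \<in> X \<and>
    (\<exists>g\<in>X. (\<forall>x\<in>\<Omega>. 0 \<le> g x) \<and>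
      (\<exists>S\<subseteq>\<Omega>. S \<in> null_sets lebesgue \<and>
        (\<forall>x\<in>\<Omega> - S. \<forall>y\<in>\<Omega> - S. ball x (3 * dist x y) \<subseteq> \<Omega> \<longrightarrow>
          \<bar>f x - f y\<bar> \<le> dist x y * (g x + g y))))"
proof -
  interpret banach_function_space \<Omega> X N by fact
  show ?thesis
  proof
    assume "f \<in> W1 \<Omega> X"
    then obtain G where f: "f \<in> X" and G: "weak_gradient \<Omega> f G" "(\<lambda>x. norm (G x)) \<in> X"
      by (auto simp: W1_def)
    let ?M = "maximal_function (zero_extend \<Omega> (\<lambda>x. norm (G x)))"
    let ?g = "\<lambda>x. 2 ^ CARD('n) * enn2real (?M x)"
    have M: "AE x in lebesgue_on \<Omega>. ?M x < \<infinity>" "(\<lambda>x. enn2real (?M x)) \<in> X"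
      using \<open>maximal_operator_bounded \<Omega> X N\<close> G(2) unfolding maximal_operator_bounded_def by blast+
    have "?g \<in> X" using M(2) by (rule scale_mem)
    moreover have "\<forall>x\<in>\<Omega>. 0 \<le> ?g x" by simp
    ultimately show "f \<in> X \<and> (\<exists>g\<in>X. (\<forall>x\<in>\<Omega>. 0 \<le> g x) \<and> (\<exists>S\<subseteq>\<Omega>. S \<in> null_sets lebesgue \<and>
        (\<forall>x\<in>\<Omega> - S. \<forall>y\<in>\<Omega> - S. ball x (3 * dist x y) \<subseteq> \<Omega> \<longrightarrow> \<bar>f x - f y\<bar> \<le> dist x y * (g x + g y))))"
      using f Hajlasz_gradient_of_weak_gradient[OF \<open>open \<Omega>\<close> G(1) M(1)] by (intro conjI bexI[of _ ?g])
  next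
    assume "f \<in> X \<and> (\<exists>g\<in>X. (\<forall>x\<in>\<Omega>. 0 \<le> g x) \<and> (\<exists>S\<subseteq>\<Omega>. S \<in> null_sets lebesgue \<and>
        (\<forall>x\<in>\<Omega> - S. \<forall>y\<in>\<Omega> - S. ball x (3 * dist x y) \<subseteq> \<Omega> \<longrightarrow> \<bar>f x - f y\<bar> \<le> dist x y * (g x + g y))))"
    then obtain g S where f: "f \<in> X" and g: "g \<in> X" "\<And>x. x \<in> \<Omega> \<Longrightarrow> 0 \<le> g x" and S: "S \<in> null_sets lebesgue"
      and ineq: "\<And>x y. x \<in> \<Omega> - S \<Longrightarrow> y \<in> \<Omega> - S \<Longrightarrow> ball x (3 * dist x y) \<subseteq> \<Omega> \<Longrightarrow>
        \<bar>f x - f y\<bar> \<le> dist x y * (g x + g y)"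
      by blast
    have L: "f \<in> L1_loc \<Omega>" "g \<in> L1_loc \<Omega>" using f g subset_L1_loc by auto
    obtain G where G: "weak_gradient \<Omega> f G" "G \<in> borel_measurable borel"
      "AE x in lebesgue_on \<Omega>. norm (G x) \<le> 2 * real CARD('n) * g x"
      by (rule weak_gradient_of_Hajlasz_gradient[OF \<open>open \<Omega>\<close> L g(2) S ineq])
    have "(\<lambda>x. norm (G x)) \<in> borel_measurable lebesgue"
      using G(2) by (intro measurable_completion) simp
    then have "(\<lambda>x. norm (G x)) \<in> borel_measurable (lebesgue_on \<Omega>)" by (rule measurable_restrict_space1)
    moreover have "(\<lambda>x. 2 * real CARD('n) * g x) \<in> X" using g(1) by (rule scale_mem)
    moreover have "AE x in lebesgue_on \<Omega>. \<bar>norm (G x)\<bar> \<le> \<bar>2 * real CARD('n) * g x\<bar>"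
      using G(3) by eventually_elim simp
    ultimately have "(\<lambda>x. norm (G x)) \<in> X \<and> N (\<lambda>x. norm (G x)) \<le> N (\<lambda>x. 2 * real CARD('n) * g x)"
      by (rule \<open>lattice_property \<Omega> X N\<close>[unfolded lattice_property_def, THEN bspec, THEN bspec, THEN mp])
    then have "(\<lambda>x. norm (G x)) \<in> X" by (rule conjunct1)
    with f G(1) show "f \<in> W1 \<Omega> X" by (auto simp: W1_def)
  qed
qed

end
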